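(* Let $p^*$ be the optimal value of the infinite-dimensional linear program $$ \begin{array}{rll} p^*=\sup & \int 1\,d\mu_0 &\\ \mathrm{s.t.} & \int v\,d\mu_T^1+\int v(T,\cdot)\,d\mu_T^2-\int v(0,\cdot)\,d\mu_0=\int \mathcal{L}v\,d\mu & \forall\, v\in C^1([0,T]\times\bar X),\\ & \int w\,d\mu_0+\int w\,d\hat\mu_0=\int_{\bar X} w\,d\lambda & \forall\, w\in C(\bar X),\\ & \mu_0\ge 0,\ \mu\ge 0,\ \mu_T^1\ge 0,\ \mu_T^2\ge 0,\ \hat\mu_0\ge 0, &\\ & \mathrm{spt}\,\mu\subset[0,T]\times\bar X,\ \ \mathrm{spt}\,\mu_0\subset\bar X,\ \ \mathrm{spt}\,\hat\mu_0\subset\bar X, &\\ & \mathrm{spt}\,\mu_T^1\subset[0,T]\times X_\partial,\ \ \mathrm{spt}\,\mu_T^2\subset X_T^c, & \end{array} $$ where the supremum is over vectors of nonnegative measures $(\mu_0,\mu,\mu_T^1,\mu_T^2,\hat\mu_0)\in M(\bar X)\times M([0,T]\times\bar X)\times M([0,T]\times X_\partial)\times M(X_T^c)\times M(\bar X)$. Then $$p^*=\lambda(X_0^c).$$ Moreover, the supremum is attained with $\mu_0$ equal to the restriction of the Lebesgue measure $\lambda$ to $X_0^c$ (that is, there is a feasible vector $(\mu_0,\mu,\mu_T^1,\mu_T^2,\hat\mu_0)$ whose $\mu_0$-component is this restriction, and it is optimal).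
   Context: Setting. Fix $n\ge 1$, $T>0$, and a polynomial vector field $f=(f_1,\dots,f_n)$ with $f_i\in\mathbb{R}[t,x]$, $x\in\mathbb{R}^n$, defining the ODE $\dot x(t)=f(t,x(t))$. Let $g_X,g_T\in\mathbb{R}[x]$ and $$X=\{x\in\mathbb{R}^n: g_X(x)>0\},\quad \bar X=\{x\in\mathbb{R}^n: g_X(x)\ge 0\},\quad X_\partial=\{x\in\mathbb{R}^n: g_X(x)=0\},$$ where $X$ is nonempty and $\bar X$ is compact ($\bar X$ need not be the closure of $X$). The target set is $X_T=\{x\in\mathbb{R}^n: g_T(x)>0\}$, assumed to be bounded and to satisfy $X_T\subset X$. Put $X_T^c=\{x\in\mathbb{R}^n: g_X(x)\ge 0,\ g_T(x)\le 0\}$. The region of attraction $X_0$ is the set of all $x_0\in X$ for which there is a solution $x(\cdot)$ of $\dot x(t)=f(t,x(t))$ on $[0,T]$ with $x(0)=x_0$, $x(t)\in X$ for all $t\in[0,T]$, and $x(T)\in X_T$. The complement region of attraction is $X_0^c=X\setminus X_0$. Notation. $M(K)$ is the space of signed Borel measures with support contained in the Borel set $K$; $\mathrm{spt}\,\mu$ is the support of $\mu$; $C(K)$ and $C^1(K)$ are the spaces of continuous and continuously differentiable functions on $K$ (elements of $C^1([0,T]\times\bar X)$ are understood as continuously differentiable functions on an open neighbourhood of $[0,T]\times\bar X$). $\lambda$ is the $n$-dimensional Lebesgue measure. For $v\in C^1([0,T]\times\bar X)$, $\mathcal{L}v=\frac{\partial v}{\partial t}+\mathrm{grad}\,v\cdot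 f$, where $\mathrm{grad}$ is the gradient in $x$. *)

theory Defs
  imports "HOL-Analysis.Analysis"
begin

text \<open>
  \<open>\<real>\<^sup>n\<close> is \<^typ>\<open>real ^ 'n\<close> and time-space is \<^typ>\<open>real \<times> (real ^ 'n)\<close>. Polynomials are represented by
  the functions they induce (the inductive predicate \<^const>\<open>real_polynomial_function\<close>), which
  over \<open>\<real>\<close> is the same as formal polynomials.
\<close>

definition inner_set :: "(real ^ 'n \<Rightarrow> real) \<Rightarrow> (real ^ 'n) set" where
  "inner_set gX = {x. gX x > 0}"

definition outer_set :: "(real ^ 'n \<Rightarrow> real) \<Rightarrow> (real ^ 'n) set" where
  "outer_set gX = {x. gX x \<ge> 0}"

definition boundary_set :: "(real ^ 'n \<Rightarrow> real) \<Rightarrow> (real ^ 'n) set" where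
  "boundary_set gX = {x. gX x = 0}"

definition target_set :: "(real ^ 'n \<Rightarrow> real) \<Rightarrow> (real ^ 'n) set" where
  "target_set gT = {x. gT x > 0}"

definition target_compl :: "(real ^ 'n \<Rightarrow> real) \<Rightarrow> (real ^ 'n \<Rightarrow> real) \<Rightarrow> (real ^ 'n) set" where
  "target_compl gX gT = {x. gX x \<ge> 0 \<and> gT x \<le> 0}"

definition solution_on :: "real \<Rightarrow> (real \<Rightarrow> real ^ 'n \<Rightarrow> real ^ 'n) \<Rightarrow> (real \<Rightarrow> real ^ 'n) \<Rightarrow> bool" where
  "solution_on T f x \<longleftrightarrow>
     (\<forall>t\<in>{0..T}. (x has_vector_derivative f t (x t)) (at t within {0..T}))"

definition attraction_region ::
  "real \<Rightarrow> (real \<Rightarrow> real ^ 'n \<Rightarrow> real ^ 'n) \<Rightarrow> (real ^ 'n \<Rightarrow> real) \<Rightarrow> (real ^ 'n \<Rightarrow> real) \<Rightarrow> (real ^ 'n) set"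
  where
  "attraction_region T f gX gT =
     {x0 \<in> inner_set gX. \<exists>x. solution_on T f x \<and> x 0 = x0 \<and>
        (\<forall>t\<in>{0..T}. x t \<in> inner_set gX) \<and> x T \<in> target_set gT}"

definition attraction_compl ::
  "real \<Rightarrow> (real \<Rightarrow> real ^ 'n \<Rightarrow> real ^ 'n) \<Rightarrow> (real ^ 'n \<Rightarrow> real) \<Rightarrow> (real ^ 'n \<Rightarrow> real) \<Rightarrow> (real ^ 'n) set"
  where
  "attraction_compl T f gX gT = inner_set gX - attraction_region T f gX gT"

definition spt :: "'a::topological_space measure \<Rightarrow> 'a set" where
  "spt \<mu> = {x. \<forall>U. open U \<and> x \<in> U \<longrightarrow> emeasure \<mu> U > 0}"

text \<open>
  The nonnegative elements of \<open>M(K)\<close>. Elements of \<open>M(K)\<close> are signed measures, hence finite.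
\<close>
definition nonneg_measures :: "'a::topological_space set \<Rightarrow> 'a measure set" where
  "nonneg_measures K = {\<mu>. sets \<mu> = sets borel \<and> finite_measure \<mu> \<and> spt \<mu> \<subseteq> K}"

definition C1_nbhd :: "'a::real_normed_vector set \<Rightarrow> ('a \<Rightarrow> real) set" where
  "C1_nbhd K = {v. \<exists>U v'. open U \<and> K \<subseteq> U \<and>
     (\<forall>z\<in>U. (v has_derivative blinfun_apply (v' z)) (at z)) \<and> continuous_on U v'}"

definition space_grad :: "(real \<times> (real ^ 'n) \<Rightarrow> real) \<Rightarrow> real \<Rightarrow> real ^ 'n \<Rightarrow> real ^ 'n" where
  "space_grad v t x = (\<chi> i. deriv (\<lambda>h. v (t, x + h *\<^sub>R axis i 1)) 0)"

definition Lop ::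
  "(real \<Rightarrow> real ^ 'n \<Rightarrow> real ^ 'n) \<Rightarrow> (real \<times> (real ^ 'n) \<Rightarrow> real) \<Rightarrow> real \<times> (real ^ 'n) \<Rightarrow> real" where
  "Lop f v = (\<lambda>(t, x). deriv (\<lambda>s. v (s, x)) t + space_grad v t x \<bullet> f t x)"

text \<open>
  Integrals are taken over the sets carrying the measures, because the test functions are
  arbitrary (possibly non-measurable) away from those sets.
\<close>
definition feasible ::
  "real \<Rightarrow> (real \<Rightarrow> real ^ 'n \<Rightarrow> real ^ 'n) \<Rightarrow> (real ^ 'n \<Rightarrow> real) \<Rightarrow> (real ^ 'n \<Rightarrow> real) \<Rightarrow>
   (real ^ 'n) measure \<Rightarrow> (real \<times> (real ^ 'n)) measure \<Rightarrow> (real \<times> (real ^ 'n)) measure \<Rightarrow>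
   (real ^ 'n) measure \<Rightarrow> (real ^ 'n) measure \<Rightarrow> bool" where
  "feasible T f gX gT \<mu>0 \<mu> \<mu>T1 \<mu>T2 \<mu>h0 \<longleftrightarrow>
     \<mu>0 \<in> nonneg_measures (outer_set gX) \<and>
     \<mu> \<in> nonneg_measures ({0..T} \<times> outer_set gX) \<and>
     \<mu>T1 \<in> nonneg_measures ({0..T} \<times> boundary_set gX) \<and>
     \<mu>T2 \<in> nonneg_measures (target_compl gX gT) \<and>
     \<mu>h0 \<in> nonneg_measures (outer_set gX) \<and>
     (\<forall>v \<in> C1_nbhd ({0..T} \<times> outer_set gX).
        (LINT z:{0..T} \<times> boundary_set gX|\<mu>T1. v z)
        + (LINT x:target_compl gX gT|\<mu>T2. v (T, x))
        - (LINT x:outer_set gX|\<mu>0. v (0, x))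
        = (LINT z:{0..T} \<times> outer_set gX|\<mu>. Lop f v z)) \<and>
     (\<forall>w :: real ^ 'n \<Rightarrow> real. continuous_on (outer_set gX) w \<longrightarrow>
        (LINT x:outer_set gX|\<mu>0. w x) + (LINT x:outer_set gX|\<mu>h0. w x)
        = (LINT x:outer_set gX|lborel. w x))"

definition p_star ::
  "real \<Rightarrow> (real \<Rightarrow> real ^ 'n \<Rightarrow> real ^ 'n) \<Rightarrow> (real ^ 'n \<Rightarrow> real) \<Rightarrow> (real ^ 'n \<Rightarrow> real) \<Rightarrow> ereal" where
  "p_star T f gX gT =
     Sup {ereal (LINT x|\<mu>0. 1) | \<mu>0 \<mu> \<mu>T1 \<mu>T2 \<mu>h0. feasible T f gX gT \<mu>0 \<mu> \<mu>T1 \<mu>T2 \<mu>h0}"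

end

theory Submission
  imports Defs
begin

text \<open>
  The optimal value is bounded from above by explicit test functions, and an explicit vector of
  measures attains the bound.

  Upper bound. Let \<open>x\<close> belong to the region of attraction and let \<open>p\<close> be its trajectory. A thin
  tube around \<open>p\<close>, widening at the rate at which trajectories can separate, stays in \<open>{gX > 0}\<close>
  and ends in the target. It carries a nonnegative \<open>C\<^sup>1\<close> function \<open>v\<close>, positive at \<open>(0, x)\<close>, that
  does not decrease along trajectories in \<open>{gX \<ge> 0}\<close> (\<open>tube_test_function\<close>). In the transport
  equation both terminal terms vanish for this \<open>v\<close>, and what remains forces the integral of
  \<open>v (0, _)\<close> over \<open>\<mu>0\<close> to be nonpositive. Hence \<open>x\<close> is not in the support of any feasible \<open>\<mu>0\<close>
  (\<open>attraction_region_avoids_spt\<close>). As \<open>\<mu>0\<close> is dominated by Lebesgue measure on \<open>{gX \<ge> 0}\<close>, its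
  mass is at most the measure of \<open>{gX \<ge> 0}\<close> minus the region of attraction, and this is the
  measure of the complement region because the zero set of a nonzero polynomial is null
  (\<open>feasible_mass_le\<close>, \<open>real_polynomial_function_zeros_null\<close>).

  Attainment. The set \<open>{gX \<ge> 0}\<close> is compact, so \<open>f\<close> agrees on it with a globally Lipschitz field,
  which has a continuous flow on \<open>[0, T]\<close> (\<open>real_polynomial_field_extension\<close>, \<open>ode_flow_exists\<close>).
  By continuity of the flow the region of attraction is open. Starting with Lebesgue measure on
  the complement region, follow each point until it first meets \<open>{gX = 0}\<close>, or until time \<open>T\<close>. A
  point that never meets this set ends outside the target. The occupation measure and the
  distributions of the stopped points are feasible by the fundamental theorem of calculus and
  Fubini's theorem (\<open>feasible_flow\<close>), and the mass of the initial measure equals the upper bound.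
\<close>

section \<open>Polynomial functions\<close>

text \<open>
  Induction over the formation of the polynomial. Products need a bound on the factors as well as
  their Lipschitz constants, so the induction carries both.
\<close>
lemma real_polynomial_function_lipschitz_on_bounded:
  fixes p :: "'a::real_normed_vector \<Rightarrow> real"
  assumes "real_polynomial_function p" and S: "bounded S"
  shows "\<exists>L. L-lipschitz_on S p"
proof -
  obtain B where B: "\<And>x. x \<in> S \<Longrightarrow> norm x \<le> B" "B \<ge> 0"
    using S by (metis bounded_pos less_imp_le)
  have "\<exists>L M. L \<ge> 0 \<and> M \<ge> 0 \<and> (\<forall>x\<in>S. \<bar>p x\<bar> \<le> M) \<and> (\<forall>x\<in>S. \<forall>y\<in>S. \<bar>p x - p y\<bar> \<le> L * norm (x - y))"
    using assms(1)
  proof induction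
    case (linear h)
    then obtain K where K: "K > 0" "\<And>x. norm (h x) \<le> norm x * K"
      using bounded_linear.pos_bounded by blast
    have "\<bar>h x\<bar> \<le> B * K" if "x \<in> S" for x
      using K(2)[of x] B(1)[OF that] K(1) by (smt (verit) mult_right_mono real_norm_def)
    moreover have "\<bar>h x - h y\<bar> \<le> K * norm (x - y)" for x y
      using K(2)[of "x - y"] linear by (simp add: bounded_linear.linear linear_diff mult.commute)
    ultimately show ?case using K(1) B(2)
      by (intro exI[of _ K] exI[of _ "B * K"]) auto
  next
    case (const c)
    then show ?case by (intro exI[of _ 0] exI[of _ "\<bar>c\<bar>"]) auto
  next
    case (add g h)
    then obtain L M L' M' where *: "L \<ge> 0" "M \<ge> 0" "L' \<ge> 0" "M' \<ge> 0"
      "\<And>x. x \<in> S \<Longrightarrow> \<bar>g x\<bar> \<le> M" "\<And>x. x \<in> S \<Longrightarrow> \<bar>h x\<bar> \<le> M'"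
      "\<And>x y. x \<in> S \<Longrightarrow> y \<in> S \<Longrightarrow> \<bar>g x - g y\<bar> \<le> L * norm (x - y)"
      "\<And>x y. x \<in> S \<Longrightarrow> y \<in> S \<Longrightarrow> \<bar>h x - h y\<bar> \<le> L' * norm (x - y)" by metis
    have "\<bar>g x + h x - (g y + h y)\<bar> \<le> (L + L') * norm (x - y)" if "x \<in> S" "y \<in> S" for x y
      using *(7)[OF that] *(8)[OF that] by (simp add: distrib_right)
    moreover have "\<bar>g x + h x\<bar> \<le> M + M'" if "x \<in> S" for x
      using *(5)[OF that] *(6)[OF that] by linarith
    ultimately show ?case using * by (intro exI[of _ "L + L'"] exI[of _ "M + M'"]) auto
  next
    case (mult g h)
    then obtain L M L' M' where *: "L \<ge> 0" "M \<ge> 0" "L' \<ge> 0" "M' \<ge> 0"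
      "\<And>x. x \<in> S \<Longrightarrow> \<bar>g x\<bar> \<le> M" "\<And>x. x \<in> S \<Longrightarrow> \<bar>h x\<bar> \<le> M'"
      "\<And>x y. x \<in> S \<Longrightarrow> y \<in> S \<Longrightarrow> \<bar>g x - g y\<bar> \<le> L * norm (x - y)"
      "\<And>x y. x \<in> S \<Longrightarrow> y \<in> S \<Longrightarrow> \<bar>h x - h y\<bar> \<le> L' * norm (x - y)" by metis
    have "\<bar>g x * h x - g y * h y\<bar> \<le> (M * L' + L * M') * norm (x - y)" if "x \<in> S" "y \<in> S" for x y
    proof -
      have "g x * h x - g y * h y = g x * (h x - h y) + (g x - g y) * h y"
        by (simp add: algebra_simps)
      then have "\<bar>g x * h x - g y * h y\<bar> \<le> \<bar>g x\<bar> * \<bar>h x - h y\<bar> + \<bar>g x - g y\<bar> * \<bar>h y\<bar>"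
        by (metis abs_mult abs_triangle_ineq)
      also have "\<dots> \<le> M * (L' * norm (x - y)) + (L * norm (x - y)) * M'"
        using *(5)[OF that(1)] *(6)[OF that(2)] *(7)[OF that] *(8)[OF that] *(1-4)
        by (intro add_mono mult_mono) auto
      finally show ?thesis by (simp add: algebra_simps)
    qed
    moreover have "\<bar>g x * h x\<bar> \<le> M * M'" if "x \<in> S" for x
      using *(5)[OF that] *(6)[OF that] *(2,4) by (simp add: abs_mult mult_mono)
    ultimately show ?case using * by (intro exI[of _ "M * L' + L * M'"] exI[of _ "M * M'"]) auto
  qed
  then show ?thesis
    unfolding lipschitz_on_def dist_norm by (metis real_norm_def)
qed

lemma continuous_on_real_polynomial_function:
  "real_polynomial_function p \<Longrightarrow> continuous_on S p"
  by (simp add: continuous_on_polymonial_function real_polynomial_function_eq)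

text \<open>
  On every line through \<open>a\<close> the polynomial is a nonzero polynomial in one variable, which has
  finitely many roots. By Fubini, for almost every factor \<open>c\<close> the dilation with centre \<open>a\<close> and
  factor \<open>c\<close> takes almost no point into the zero set. One such \<open>c \<noteq> 0\<close> suffices, because a
  dilation maps Lebesgue measure to a constant multiple of itself.
\<close>
lemma real_polynomial_function_zeros_null:
  fixes p :: "'a::euclidean_space \<Rightarrow> real"
  assumes p: "real_polynomial_function p" and a: "p a \<noteq> 0"
  shows "{x. p x = 0} \<in> null_sets lborel"
proof -
  have cont: "continuous_on UNIV p"
    using p by (rule continuous_on_real_polynomial_function)
  have [measurable]: "p \<in> borel_measurable borel"
    using cont by (rule borel_measurable_continuous_onI)
  have ray: "AE c in lborel. p (a + c *\<^sub>R (x - a)) \<noteq> 0" for x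
  proof -
    have "polynomial_function (\<lambda>c::real. a + c *\<^sub>R (x - a))"
      by (intro polynomial_function_add polynomial_function_const
            polynomial_function_bounded_linear bounded_linear_scaleR_left)
    then have "real_polynomial_function (p \<circ> (\<lambda>c. a + c *\<^sub>R (x - a)))"
      using p by (rule real_polynomial_function_compose)
    then obtain b n where b: "p \<circ> (\<lambda>c. a + c *\<^sub>R (x - a)) = (\<lambda>c. \<Sum>i\<le>n. b i * c ^ i)"
      using real_polynomial_function_iff_sum by blast
    have b': "p (a + c *\<^sub>R (x - a)) = (\<Sum>i\<le>n. b i * c ^ i)" for c
      using fun_cong[OF b, of c] by simp
    have "(\<Sum>i\<le>n. b i * 0 ^ i) \<noteq> 0"
      using b'[of 0] a by simp
    then obtain k where k: "k \<le> n" "b k \<noteq> 0"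
      by (metis (no_types, lifting) atMost_iff mult_eq_0_iff sum.neutral)
    have "finite {c::real. (\<Sum>i\<le>n. b i * c ^ i) = 0}"
      using k(2,1) by (rule polyfun_roots_finite)
    then have "finite {c. p (a + c *\<^sub>R (x - a)) = 0}"
      by (simp add: b')
    then have "{c. p (a + c *\<^sub>R (x - a)) = 0} \<in> null_sets lborel"
      by (rule finite_imp_null_set_lborel)
    then show ?thesis
      by (auto simp: eventually_ae_filter intro!: bexI[rotated])
  qed
  have meas: "{z \<in> space ((lborel :: real measure) \<Otimes>\<^sub>M (lborel :: 'a measure)).
      p (a + fst z *\<^sub>R (snd z - a)) \<noteq> 0} \<in> sets (lborel \<Otimes>\<^sub>M lborel)"
    by measurable
  have "AE c in lborel. AE x in lborel. p (a + c *\<^sub>R (x - a)) \<noteq> 0"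
    using lborel_pair.AE_commute[OF meas] ray by simp
  moreover have "AE c in lborel. c \<noteq> (0::real)"
    by (rule AE_lborel_singleton)
  ultimately have "AE c in lborel. c \<noteq> (0::real) \<and> (AE x in lborel. p (a + c *\<^sub>R (x - a)) \<noteq> 0)"
    by eventually_elim simp
  then have "\<exists>c::real. c \<noteq> 0 \<and> (AE x in lborel. p (a + c *\<^sub>R (x - a)) \<noteq> 0)"
    using eventually_happens[of _ "ae_filter (lborel :: real measure)"]
    by (auto simp: ae_filter_eq_bot_iff)
  then obtain c :: real where c: "c \<noteq> 0" "AE x in lborel. p (a + c *\<^sub>R (x - a)) \<noteq> 0"
    by blast
  have [measurable]: "(\<lambda>x. (a - c *\<^sub>R a) + c *\<^sub>R x) \<in> borel_measurable lborel" by measurable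
  have eq: "(a - c *\<^sub>R a) + c *\<^sub>R x = a + c *\<^sub>R (x - a)" for x
    by (simp add: algebra_simps)
  have "AE x in lborel. p x \<noteq> 0"
    apply (subst lborel_affine[OF c(1), of "a - c *\<^sub>R a"])
    apply (subst AE_density, simp)
    apply (subst AE_distr_iff)
    using c by (auto simp: eq)
  then show ?thesis
    by (subst AE_iff_null_sets) (auto, measurable)
qed

section \<open>Flows of globally Lipschitz vector fields\<close>

text \<open>
  The nearest-point retraction of the time axis onto \<open>[0, T]\<close>. It turns data given on \<open>[0, T]\<close>
  into functions on all of \<open>\<real>\<close>.
\<close>
definition clip :: "real \<Rightarrow> real \<Rightarrow> real" where "clip T t = max 0 (min T t)"

lemma clip_in: "0 \<le> T \<Longrightarrow> clip T t \<in> {0..T}" by (auto simp: clip_def)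
lemma clip_id: "t \<in> {0..T} \<Longrightarrow> clip T t = t" by (auto simp: clip_def)
lemma continuous_on_clip [continuous_intros]:
  "continuous_on S g \<Longrightarrow> continuous_on S (\<lambda>x. clip T (g x))"
  unfolding clip_def by (intro continuous_intros)

text \<open>
  Banach's fixed point theorem, applied once on the whole interval: the unknown is
  \<open>z t = exp (- 2 L t) y t\<close>, and with this exponential weight the Picard operator contracts the
  supremum norm by \<open>1/2\<close> for every \<open>T\<close>. Clipping time makes \<open>z\<close> an element of the complete space
  of bounded continuous functions on \<open>\<real>\<close>.
\<close>
lemma picard_lindelof:
  fixes F :: "real \<Rightarrow> 'a::banach \<Rightarrow> 'a"
  assumes T: "0 \<le> T" and L: "0 < L"
    and cont: "continuous_on ({0..T} \<times> UNIV) (\<lambda>(t, x). F t x)"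
    and lip: "\<And>t x y. t \<in> {0..T} \<Longrightarrow> norm (F t x - F t y) \<le> L * norm (x - y)"
  shows "\<exists>y. y 0 = x0 \<and> (\<forall>t\<in>{0..T}. (y has_vector_derivative F t (y t)) (at t within {0..T}))"
proof -
  define N where "N z s = F s (exp (2 * L * s) *\<^sub>R z s)" for z :: "real \<Rightarrow> 'a" and s
  define P where "P z t = exp (- 2 * L * clip T t) *\<^sub>R (x0 + integral {0..clip T t} (N z))"
    for z :: "real \<Rightarrow> 'a" and t
  have N_cont: "continuous_on {0..T} (N z)" if "continuous_on UNIV z" for z
  proof -
    have "continuous_on {0..T} ((\<lambda>(t, x). F t x) \<circ> (\<lambda>s. (s, exp (2 * L * s) *\<^sub>R z s)))"
      by (intro continuous_on_compose continuous_intros continuous_on_subset[OF that]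
          continuous_on_subset[OF cont]) auto
    then show ?thesis by (simp add: N_def o_def)
  qed
  have z_cont: "continuous_on UNIV (apply_bcontfun z)" for z :: "real \<Rightarrow>\<^sub>C 'a"
    using apply_bcontfun[of z] by (simp add: bcontfun_def)
  have int: "N z integrable_on {0..t}" if "t \<in> {0..T}" "continuous_on UNIV z" for z t
    using that by (intro integrable_continuous_real continuous_on_subset[OF N_cont]) auto
  have P_bc: "P z \<in> bcontfun" if z: "continuous_on UNIV z" for z
  proof -
    define G where "G t = exp (- 2 * L * t) *\<^sub>R (x0 + integral {0..t} (N z))" for t
    have G: "continuous_on {0..T} G"
      unfolding G_def using int[OF _ z, of T] T
      by (intro continuous_intros indefinite_integral_continuous_1) auto
    have PG: "P z = G \<circ> clip T" by (auto simp: P_def G_def)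
    have im: "clip T ` UNIV \<subseteq> {0..T}" using clip_in[OF T] by auto
    have "continuous_on UNIV (P z)"
      unfolding PG by (intro continuous_on_compose continuous_intros continuous_on_id
          continuous_on_subset[OF G im])
    moreover have "bounded (range (P z))"
    proof (rule bounded_subset)
      show "bounded (G ` {0..T})"
        using compact_continuous_image[OF G] compact_imp_bounded by blast
      show "range (P z) \<subseteq> G ` {0..T}" unfolding PG using im by auto
    qed
    ultimately show ?thesis by (simp add: bcontfun_def)
  qed
  define Q where "Q z = Bcontfun (P (apply_bcontfun z))" for z :: "real \<Rightarrow>\<^sub>C 'a"
  have Q: "apply_bcontfun (Q z) = P (apply_bcontfun z)" for z
    unfolding Q_def by (rule Bcontfun_inverse[OF P_bc[OF z_cont]])
  have contr: "dist (Q z) (Q w) \<le> 1/2 * dist z w" for z w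
  proof (rule dist_bound)
    fix t
    define c where "c = clip T t"
    define d where "d = dist z w"
    have c: "c \<in> {0..T}" using clip_in[OF T] c_def by simp
    have Nd: "norm (N z s - N w s) \<le> L * exp (2 * L * s) * d" if "s \<in> {0..c}" for s
    proof -
      have "norm (N z s - N w s) \<le> L * norm (exp (2 * L * s) *\<^sub>R z s - exp (2 * L * s) *\<^sub>R w s)"
        unfolding N_def using that c by (intro lip) auto
      also have "\<dots> = L * exp (2 * L * s) * dist (z s) (w s)"
        by (simp add: dist_norm flip: scaleR_diff_right)
      also have "\<dots> \<le> L * exp (2 * L * s) * d"
        unfolding d_def using L dist_bounded by (intro mult_left_mono) auto
      finally show ?thesis .
    qed
    have E: "((\<lambda>s. L * exp (2 * L * s) * d) has_integral (exp (2 * L * c) - 1) / 2 * d) {0..c}"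
    proof -
      have "((\<lambda>s. L * exp (2 * L * s) * d) has_integral
          (exp (2 * L * c) / 2 * d - exp (2 * L * 0) / 2 * d)) {0..c}"
        using c by (intro fundamental_theorem_of_calculus)
          (auto intro!: derivative_eq_intros simp flip: has_real_derivative_iff_has_vector_derivative)
      then show ?thesis by (simp add: diff_divide_distrib left_diff_distrib)
    qed
    have "norm (integral {0..c} (N z) - integral {0..c} (N w)) = norm (integral {0..c} (\<lambda>s. N z s - N w s))"
      using int[OF c z_cont] by (subst integral_diff) auto
    also have "\<dots> \<le> integral {0..c} (\<lambda>s. L * exp (2 * L * s) * d)"
      using int[OF c z_cont] E Nd by (intro integral_norm_bound_integral integrable_diff) auto
    also have "\<dots> = (exp (2 * L * c) - 1) / 2 * d" using E by (rule integral_unique)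
    finally have I: "norm (integral {0..c} (N z) - integral {0..c} (N w)) \<le> (exp (2 * L * c) - 1) / 2 * d" .
    have "dist (Q z t) (Q w t) = exp (- (2 * L * c)) * norm (integral {0..c} (N z) - integral {0..c} (N w))"
      by (simp add: Q P_def dist_norm flip: scaleR_diff_right c_def)
    also have "\<dots> \<le> exp (- (2 * L * c)) * ((exp (2 * L * c) - 1) / 2 * d)"
      using I by (intro mult_left_mono) auto
    also have "\<dots> = (1 - exp (- (2 * L * c))) / 2 * d"
      by (simp add: exp_minus field_simps)
    also have "\<dots> \<le> 1/2 * d"
      unfolding d_def by (intro mult_right_mono) auto
    finally show "dist (Q z t) (Q w t) \<le> 1/2 * dist z w" by (simp add: d_def)
  qed
  obtain z where z: "Q z = z"
    using banach_fix_type[of "1/2" Q] contr by auto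
  define y where "y t = x0 + integral {0..t} (N z)" for t
  have yz: "exp (2 * L * t) *\<^sub>R z t = y t" if "t \<in> {0..T}" for t
  proof -
    have "z t = P z t" by (metis Q z)
    also have "\<dots> = exp (- 2 * L * t) *\<^sub>R y t"
      unfolding P_def y_def by (simp only: clip_id[OF that])
    finally show ?thesis by (simp flip: exp_add)
  qed
  have "(y has_vector_derivative F t (y t)) (at t within {0..T})" if "t \<in> {0..T}" for t
  proof -
    have "(y has_vector_derivative N z t) (at t within {0..T})"
      unfolding y_def using integral_has_vector_derivative[OF N_cont[OF z_cont] that]
      by (auto intro!: derivative_eq_intros)
    then show ?thesis by (simp add: N_def yz[OF that])
  qed
  moreover have "y 0 = x0" by (simp add: y_def)
  ultimately show ?thesis by blast
qed

text \<open>
  Gronwall's estimate: \<open>exp (- 2 L t) |y t - z t|\<^sup>2\<close> has nonpositive derivative. Equal initial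
  values give uniqueness.
\<close>
lemma ode_dependence_on_initial_value:
  fixes F :: "real \<Rightarrow> 'a::real_inner \<Rightarrow> 'a"
  assumes lip: "\<And>t. t \<in> {0..T} \<Longrightarrow> norm (F t (y t) - F t (z t)) \<le> L * norm (y t - z t)"
    and y: "\<And>t. t \<in> {0..T} \<Longrightarrow> (y has_vector_derivative F t (y t)) (at t within {0..T})"
    and z: "\<And>t. t \<in> {0..T} \<Longrightarrow> (z has_vector_derivative F t (z t)) (at t within {0..T})"
    and t: "t \<in> {0..T}"
  shows "norm (y t - z t) \<le> exp (L * t) * norm (y 0 - z 0)"
proof -
  define w where "w s = y s - z s" for s
  define u where "u s = exp (- (2 * L * s)) * (w s \<bullet> w s)" for s
  define D where "D s = exp (- (2 * L * s)) * (2 * (w s \<bullet> (F s (y s) - F s (z s)) - L * (w s \<bullet> w s)))" for s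
  have u: "(u has_real_derivative D s) (at s within {0..T})" if "s \<in> {0..T}" for s
  proof -
    have "(w has_vector_derivative F s (y s) - F s (z s)) (at s within {0..T})"
      unfolding w_def using y[OF that] z[OF that] by (rule has_vector_derivative_diff)
    then have "((\<lambda>s. w s \<bullet> w s) has_derivative
        (\<lambda>h. w s \<bullet> (h *\<^sub>R (F s (y s) - F s (z s))) + (h *\<^sub>R (F s (y s) - F s (z s))) \<bullet> w s))
        (at s within {0..T})"
      unfolding has_vector_derivative_def by (intro derivative_intros)
    then have "((\<lambda>s. w s \<bullet> w s) has_real_derivative 2 * (w s \<bullet> (F s (y s) - F s (z s))))
        (at s within {0..T})"
      unfolding has_field_derivative_def
      by (rule has_derivative_eq_rhs) (auto simp: fun_eq_iff inner_commute)
    then show ?thesis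
      unfolding u_def D_def
      by (auto intro!: derivative_eq_intros simp: algebra_simps)
  qed
  have D: "D s \<le> 0" if "s \<in> {0..T}" for s
  proof -
    have "w s \<bullet> (F s (y s) - F s (z s)) \<le> norm (w s) * norm (F s (y s) - F s (z s))"
      by (rule norm_cauchy_schwarz)
    also have "\<dots> \<le> norm (w s) * (L * norm (w s))"
      using lip[OF that] by (intro mult_left_mono) (auto simp: w_def)
    also have "\<dots> = L * (w s \<bullet> w s)" by (simp add: dot_square_norm power2_eq_square)
    finally show ?thesis by (simp add: D_def mult_le_0_iff)
  qed
  have "u t \<le> u 0"
  proof (rule DERIV_nonpos_imp_decreasing_open[of 0 t])
    show "0 \<le> t" using t by simp
    show "\<exists>D. (u has_real_derivative D) (at s) \<and> D \<le> 0" if "0 < s" "s < t" for s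
    proof -
      have "s \<in> {0..T}" "at s within {0..T} = at s" using that t by (auto simp: at_within_Icc_at)
      then show ?thesis using u D by metis
    qed
    have "continuous_on {0..T} u"
      by (rule DERIV_continuous_on) (rule u)
    then show "continuous_on {0..t} u" by (rule continuous_on_subset) (use t in auto)
  qed
  then have "w t \<bullet> w t \<le> exp (2 * L * t) * (w 0 \<bullet> w 0)"
    by (simp add: u_def exp_minus field_simps)
  then have "(norm (w t))\<^sup>2 \<le> (exp (L * t) * norm (w 0))\<^sup>2"
    by (simp add: dot_square_norm power_mult_distrib exp_double mult.assoc)
  then show ?thesis
    unfolding w_def by (rule power2_le_imp_le) auto
qed

text \<open>
  Clipping time makes the flow a continuous function on the whole of time-space, so that it is
  Borel measurable as it stands. Outside \<open>[0, T]\<close> its trajectories are constant.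
\<close>
lemma ode_flow_exists:
  fixes F :: "real \<Rightarrow> 'a::{banach,real_inner} \<Rightarrow> 'a"
  assumes T: "0 \<le> T" and L: "0 < L"
    and cont: "continuous_on ({0..T} \<times> UNIV) (\<lambda>(t, x). F t x)"
    and lip: "\<And>t x y. t \<in> {0..T} \<Longrightarrow> norm (F t x - F t y) \<le> L * norm (x - y)"
  obtains \<phi> :: "'a \<Rightarrow> real \<Rightarrow> 'a"
  where "\<And>x. \<phi> x 0 = x"
    "\<And>x t. t \<in> {0..T} \<Longrightarrow> (\<phi> x has_vector_derivative F t (\<phi> x t)) (at t within {0..T})"
    "continuous_on UNIV (\<lambda>(t, x). \<phi> x t)"
proof -
  have "\<forall>x. \<exists>y. y 0 = x \<and> (\<forall>t\<in>{0..T}. (y has_vector_derivative F t (y t)) (at t within {0..T}))"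
    using picard_lindelof[OF assms] by blast
  then obtain Y where Y: "\<And>x. Y x 0 = x"
    "\<And>x t. t \<in> {0..T} \<Longrightarrow> (Y x has_vector_derivative F t (Y x t)) (at t within {0..T})"
    by metis
  define \<phi> where "\<phi> x t = Y x (clip T t)" for x t
  have eq: "\<phi> x t = Y x t" if "t \<in> {0..T}" for x t
    using that by (simp add: \<phi>_def clip_id)
  have dep: "norm (\<phi> x t - \<phi> x' t) \<le> exp (L * T) * norm (x - x')" for x x' t
  proof -
    have c: "clip T t \<in> {0..T}" by (rule clip_in[OF T])
    have "norm (\<phi> x t - \<phi> x' t) \<le> exp (L * clip T t) * norm (x - x')"
      using ode_dependence_on_initial_value[where F = F and y = "Y x" and z = "Y x'" and L = L, OF lip Y(2) Y(2) c]
      by (simp add: \<phi>_def Y(1))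
    also have "\<dots> \<le> exp (L * T) * norm (x - x')"
      using c L by (intro mult_right_mono) auto
    finally show ?thesis .
  qed
  show ?thesis
  proof
    show "\<phi> x 0 = x" for x using T by (simp add: eq Y)
    show "(\<phi> x has_vector_derivative F t (\<phi> x t)) (at t within {0..T})" if "t \<in> {0..T}" for x t
      by (rule has_vector_derivative_transform[OF that eq])
         (use Y(2)[OF that] eq[OF that] in auto)
    show "continuous_on UNIV (\<lambda>(t, x). \<phi> x t)"
    proof -
      have tc: "continuous_on UNIV (\<phi> x)" for x
      proof -
        have "continuous_on {0..T} (Y x)"
          by (rule continuous_on_vector_derivative) (rule Y(2))
        then have "continuous_on UNIV (Y x \<circ> clip T)"
          using clip_in[OF T] by (intro continuous_on_compose continuous_intros
              continuous_on_id) (auto elim: continuous_on_subset)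
        then show ?thesis by (simp add: \<phi>_def[abs_def] o_def)
      qed
      have "isCont (\<lambda>(t, x). \<phi> x t) (t0, x0)" for t0 x0
      proof -
        have "((\<lambda>z. \<phi> x0 (fst z)) \<longlongrightarrow> \<phi> x0 t0) (at (t0, x0))"
          using tc[of x0] by (intro isCont_tendsto_compose[where g = "\<phi> x0"] tendsto_eq_intros)
            (auto simp: continuous_on_eq_continuous_at)
        moreover have "((\<lambda>z. \<phi> (snd z) (fst z) - \<phi> x0 (fst z)) \<longlongrightarrow> 0) (at (t0, x0))"
        proof (rule Lim_null_comparison)
          show "\<forall>\<^sub>F z in at (t0, x0). norm (\<phi> (snd z) (fst z) - \<phi> x0 (fst z)) \<le> exp (L * T) * norm (snd z - x0)"
            using dep by simp
          show "((\<lambda>z. exp (L * T) * norm (snd z - x0)) \<longlongrightarrow> 0) (at (t0, x0))"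
            by (auto intro!: tendsto_eq_intros)
        qed
        ultimately have "((\<lambda>z. \<phi> (snd z) (fst z)) \<longlongrightarrow> \<phi> x0 t0) (at (t0, x0))"
          using tendsto_add by fastforce
        then show ?thesis by (simp add: isCont_def case_prod_unfold)
      qed
      then show ?thesis by (auto simp: continuous_on_eq_continuous_at)
    qed
  qed
qed

lemma continuous_on_real_polynomial_field:
  fixes f :: "real \<Rightarrow> real ^ 'n \<Rightarrow> real ^ 'n"
  assumes f: "\<And>i. real_polynomial_function (\<lambda>(t, x). f t x $ i)"
  shows "continuous_on S (\<lambda>(t, x). f t x)"
proof -
  have "continuous_on S (\<lambda>z. \<chi> i. (\<lambda>(t, x). f t x $ i) z)"
    by (intro continuous_on_vec_lambda continuous_on_real_polynomial_function f)
  moreover have "(\<lambda>z. \<chi> i. (\<lambda>(t, x). f t x $ i) z) = (\<lambda>(t, x). f t x)"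
    by (auto simp: fun_eq_iff vec_eq_iff)
  ultimately show ?thesis by (simp only:)
qed

text \<open>
  A polynomial field is only locally Lipschitz. Evaluating it at the nearest point of a ball
  containing \<open>K\<close> keeps it unchanged on \<open>K\<close> and makes it globally Lipschitz, since the
  nearest-point map of a convex set is nonexpansive; its solutions then exist for all times in
  \<open>[0, T]\<close>.
\<close>
lemma real_polynomial_field_extension:
  fixes f :: "real \<Rightarrow> real ^ 'n \<Rightarrow> real ^ 'n"
  assumes T: "0 \<le> T" and f: "\<And>i. real_polynomial_function (\<lambda>(t, x). f t x $ i)" and K: "bounded K"
  obtains F L where "0 < L" "continuous_on UNIV (\<lambda>(t, x). F t x)"
    "\<And>t x y. norm (F t x - F t y) \<le> L * norm (x - y)"
    "\<And>t x. t \<in> {0..T} \<Longrightarrow> x \<in> K \<Longrightarrow> F t x = f t x"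
proof -
  obtain R where R: "R > 0" "\<And>x. x \<in> K \<Longrightarrow> norm x \<le> R" using K bounded_pos by blast
  define B where "B = cball (0 :: real ^ 'n) R"
  have B: "convex B" "closed B" "B \<noteq> {}" using R by (auto simp: B_def)
  have bB: "bounded ({0..T} \<times> B)" by (auto simp: B_def intro: bounded_Times)
  note fc = continuous_on_real_polynomial_field[OF f]
  obtain l where l: "\<And>i. (l i)-lipschitz_on ({0..T} \<times> B) (\<lambda>(t, x). f t x $ i)"
    using real_polynomial_function_lipschitz_on_bounded[OF f bB] by metis
  define L where "L = (\<Sum>i\<in>UNIV. l i) + 1"
  have l0: "l i \<ge> 0" for i using l by (rule lipschitz_on_nonneg)
  have L: "L > 0" using l0 by (simp add: L_def add_nonneg_pos sum_nonneg)
  define F where "F t x = f (clip T t) (closest_point B x)" for t x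
  have cpB: "closest_point B x \<in> B" for x using B by (simp add: closest_point_in_set)
  show ?thesis
  proof
    show "0 < L" by fact
    show "F t x = f t x" if "t \<in> {0..T}" "x \<in> K" for t x
      using that R by (simp add: F_def clip_id B_def closest_point_self)
    have "continuous_on UNIV ((\<lambda>(t, x). f t x) \<circ> (\<lambda>z. (clip T (fst z), closest_point B (snd z))))"
      by (intro continuous_on_compose continuous_intros fc
          continuous_on_compose2[OF continuous_on_closest_point[OF B, of UNIV]]) auto
    then show "continuous_on UNIV (\<lambda>(t, x). F t x)"
      by (simp add: F_def o_def case_prod_unfold)
    show "norm (F t x - F t y) \<le> L * norm (x - y)" for t x y
    proof -
      define x' y' where xy: "x' = closest_point B x" "y' = closest_point B y"
      have c: "clip T t \<in> {0..T}" using T by (rule clip_in)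
      have comp: "\<bar>(F t x - F t y) $ i\<bar> \<le> l i * norm (x' - y')" for i
      proof -
        have "dist (f (clip T t) x' $ i) (f (clip T t) y' $ i) \<le> l i * dist (clip T t, x') (clip T t, y')"
          using lipschitz_onD[OF l, of "(clip T t, x')" "(clip T t, y')" i] c cpB xy by auto
        then show ?thesis by (simp add: F_def xy dist_norm dist_Pair_Pair)
      qed
      have "norm (F t x - F t y) \<le> (\<Sum>i\<in>UNIV. \<bar>(F t x - F t y) $ i\<bar>)" by (rule norm_le_l1_cart)
      also have "\<dots> \<le> (\<Sum>i\<in>UNIV. l i * norm (x' - y'))" by (intro sum_mono comp)
      also have "\<dots> \<le> L * norm (x' - y')" by (simp add: L_def sum_distrib_right distrib_right)
      also have "\<dots> \<le> L * norm (x - y)"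
        using closest_point_lipschitz[OF B, of x y] L by (simp add: xy dist_norm)
      finally show ?thesis .
    qed
  qed
qed

section \<open>Supports and images of measures\<close>

text \<open>
  The complement of the support is the union of all open null sets; second countability (the
  Lindelof property) makes countably many of them enough.
\<close>
lemma emeasure_compl_spt:
  fixes \<mu> :: "'a::second_countable_topology measure"
  assumes s: "sets \<mu> = sets borel"
  shows "emeasure \<mu> (- spt \<mu>) = 0" "closed (spt \<mu>)"
proof -
  define \<F> where "\<F> = {U. open U \<and> emeasure \<mu> U = 0}"
  have eq: "- spt \<mu> = \<Union>\<F>"
    by (auto simp: spt_def \<F>_def zero_less_iff_neq_zero)
  then show "closed (spt \<mu>)"
    by (simp add: closed_def \<F>_def open_Union)
  obtain \<G> where G: "\<G> \<subseteq> \<F>" "countable \<G>" "\<Union>\<G> = \<Union>\<F>"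
    using Lindelof[of \<F>] unfolding \<F>_def by blast
  have "\<Union>\<G> \<in> null_sets \<mu>"
    using G by (intro null_sets_UN'[of _ "\<lambda>x. x", simplified]) (auto simp: \<F>_def null_sets_def s)
  then show "emeasure \<mu> (- spt \<mu>) = 0" using G eq by auto
qed

lemma spt_subset_imp_AE:
  fixes \<mu> :: "'a::second_countable_topology measure"
  assumes "sets \<mu> = sets borel" "spt \<mu> \<subseteq> K"
  shows "AE x in \<mu>. x \<in> K"
proof (rule AE_I)
  show "emeasure \<mu> (- spt \<mu>) = 0" "- spt \<mu> \<in> sets \<mu>"
    using emeasure_compl_spt[OF assms(1)] assms(1) by auto
qed (use assms in auto)

lemma nonneg_measuresI:
  assumes s: "sets \<mu> = sets borel" and f: "finite_measure \<mu>"
    and K: "closed K" and ae: "AE x in \<mu>. x \<in> K"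
  shows "\<mu> \<in> nonneg_measures K"
proof -
  have sp: "space \<mu> = UNIV" using sets_eq_imp_space_eq[OF s] by simp
  have "emeasure \<mu> (- K) = 0"
    using ae AE_iff_measurable[of "- K" \<mu> "\<lambda>x. x \<in> K"] K s sp by auto
  then have "spt \<mu> \<subseteq> K"
    using K by (auto simp: spt_def open_Compl)
  then show ?thesis using s f by (simp add: nonneg_measures_def)
qed

lemma set_integrable_continuous_compact:
  fixes w :: "'a::{t2_space} \<Rightarrow> 'b::{banach, second_countable_topology}"
  assumes M: "sets M = sets borel" "emeasure M K < \<infinity>" and K: "compact K" and w: "continuous_on K w"
  shows "set_integrable M K w"
proof -
  have Kb: "K \<in> sets borel" using K by (simp add: borel_compact)
  obtain B where B: "\<And>x. x \<in> K \<Longrightarrow> norm (w x) \<le> B"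
    using compact_imp_bounded[OF compact_continuous_image[OF w K]] by (auto simp: bounded_iff)
  have m: "(\<lambda>x. indicator K x *\<^sub>R w x) \<in> borel_measurable M"
    using borel_measurable_continuous_on_indicator[OF Kb w] M(1) measurable_cong_sets by blast
  show ?thesis
    unfolding set_integrable_def
    by (rule integrableI_bounded_set[of K _ _ B]) (use Kb M m B in \<open>auto split: split_indicator\<close>)
qed

text \<open>
  The indicator of a nonempty compact set is the decreasing limit of the continuous functions
  \<open>max 0 (1 - k infdist x S)\<close>, so an inequality between integrals of continuous functions passes
  to compact sets by dominated convergence.
\<close>
lemma measure_compact_le_lborel:
  fixes \<mu> :: "'a::euclidean_space measure"
  assumes s: "sets \<mu> = sets borel" "finite_measure \<mu>"
    and K: "compact K" and S: "compact S" "S \<subseteq> K"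
    and le: "\<And>w :: 'a \<Rightarrow> real. continuous_on UNIV w \<Longrightarrow> (\<And>x. 0 \<le> w x) \<Longrightarrow>
       (LINT x:K|\<mu>. w x) \<le> (LINT x:K|lborel. w x)"
  shows "measure \<mu> S \<le> measure lborel S"
proof (cases "S = {}")
  case False
  interpret finite_measure \<mu> by fact
  define w where "w k x = max 0 (1 - real k * infdist x S)" for k x
  have wc: "continuous_on A (w k)" for k A unfolding w_def by (intro continuous_intros)
  have w01: "0 \<le> w k x" "w k x \<le> 1" for k x
    using infdist_nonneg[of x S] by (auto simp: w_def)
  have w1: "w k x = 1" if "x \<in> S" for k x using that by (simp add: w_def)
  have Kb: "K \<in> sets borel" "S \<in> sets borel" using K S by (simp_all add: borel_compact)
  have fin: "emeasure lborel K < \<infinity>" using K by (rule emeasure_compact_finite)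
  have "measure \<mu> S \<le> (LINT x:K|lborel. w k x)" for k
  proof -
    have "measure \<mu> S = (\<integral>x. indicator S x \<partial>\<mu>)"
      using Kb s sets_eq_imp_space_eq[OF s(1)] by simp
    also have "\<dots> \<le> (LINT x:K|\<mu>. w k x)"
      unfolding set_lebesgue_integral_def
      using set_integrable_continuous_compact[OF s(1) _ K wc[of K k]] Kb s S w01 w1
      by (intro integral_mono) (auto simp: set_integrable_def less_top[symmetric] split: split_indicator)
    also have "\<dots> \<le> (LINT x:K|lborel. w k x)" by (rule le) (rule wc w01)+
    finally show ?thesis .
  qed
  moreover have "(\<lambda>k. LINT x:K|lborel. w k x) \<longlonglongrightarrow> (LINT x:K|lborel. indicator S x)"
    unfolding set_lebesgue_integral_def
  proof (rule integral_dominated_convergence)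
    show "integrable lborel (indicator K :: _ \<Rightarrow> real)" using Kb fin by simp
    show "AE x in lborel. norm (indicator K x *\<^sub>R w k x) \<le> indicator K x" for k
      using w01 by (auto split: split_indicator)
    show "AE x in lborel. (\<lambda>k. indicator K x *\<^sub>R w k x) \<longlonglongrightarrow> indicator K x *\<^sub>R indicator S x"
    proof (intro AE_I2 tendsto_scaleR tendsto_const)
      fix x
      show "(\<lambda>k. w k x) \<longlonglongrightarrow> indicator S x"
      proof (cases "x \<in> S")
        case True then show ?thesis by (simp add: w1)
      next
        case out: False
        then have "infdist x S > 0"
          using infdist_pos_not_in_closed[OF compact_imp_closed[OF S(1)] False] by simp
        then obtain n where n: "real n * infdist x S > 1" using reals_Archimedean3 by blast
        have "w k x = 0" if "k \<ge> n" for k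
        proof -
          have "real n * infdist x S \<le> real k * infdist x S"
            using that infdist_nonneg by (intro mult_right_mono) auto
          then show ?thesis using n by (simp add: w_def)
        qed
        then have "\<forall>\<^sub>F k in sequentially. w k x = 0" by (auto simp: eventually_sequentially)
        then show ?thesis using out by (simp add: tendsto_eventually)
      qed
    qed
  qed (use Kb borel_measurable_continuous_onI[OF wc] in \<open>auto\<close>)
  ultimately have "measure \<mu> S \<le> (LINT x:K|lborel. indicator S x)"
    by (intro LIMSEQ_le_const) auto
  also have "\<dots> = (\<integral>x. indicator S x \<partial>lborel)"
    unfolding set_lebesgue_integral_def
    using S by (intro Bochner_Integration.integral_cong) (auto split: split_indicator)
  also have "\<dots> = measure lborel S" by simp
  finally show ?thesis .
qed simp

text \<open>
  The image under \<open>h\<close> of Lebesgue measure restricted to \<open>S\<close>. All measures of the optimal solution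
  have this form.
\<close>
definition pushed :: "'a::euclidean_space set \<Rightarrow> ('a \<Rightarrow> 'b::euclidean_space) \<Rightarrow> 'b measure" where
  "pushed S h = distr (density lborel (indicator S)) borel h"

lemma density_indicator_eq_pushed:
  "density lborel (indicator S) = pushed S (\<lambda>x. x)"
  unfolding pushed_def by (subst distr_id2) auto

lemma pushed_in_nonneg_measures:
  assumes S: "S \<in> sets borel" "emeasure lborel S < \<infinity>" and h[measurable]: "h \<in> borel_measurable borel"
    and K: "closed K" "\<And>x. x \<in> S \<Longrightarrow> h x \<in> K"
  shows "pushed S h \<in> nonneg_measures K"
proof (rule nonneg_measuresI)
  note S(1)[measurable]
  have [measurable]: "K \<in> sets borel" using K by simp
  show "sets (pushed S h) = sets borel" by (simp add: pushed_def)
  have "emeasure (density lborel (indicator S)) UNIV < \<infinity>"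
    using S by (simp add: emeasure_density)
  then have "finite_measure (density lborel (indicator S))"
    by (intro finite_measureI) auto
  then show "finite_measure (pushed S h)"
    unfolding pushed_def by (rule finite_measure.finite_measure_distr) auto
  have "AE x in density lborel (indicator S). h x \<in> K"
    using K by (subst AE_density) (auto simp: indicator_def)
  then show "AE z in pushed S h. z \<in> K"
    unfolding pushed_def by (subst AE_distr_iff) auto
qed (rule K)

lemma
  assumes S: "S \<in> sets borel" and h: "h \<in> borel_measurable borel"
    and K: "closed K" "\<And>x. x \<in> S \<Longrightarrow> h x \<in> K" and w: "continuous_on K (w :: _ \<Rightarrow> real)"
  shows integral_pushed: "(LINT z:K|pushed S h. w z) = (LINT x:S|lborel. w (h x))"
    and set_integrable_pushed:
      "compact K \<Longrightarrow> emeasure lborel S < \<infinity> \<Longrightarrow> set_integrable lborel S (\<lambda>x. w (h x))"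
proof -
  note S[measurable] h[measurable]
  define u where "u z = indicator K z *\<^sub>R w z" for z
  have u[measurable]: "u \<in> borel_measurable borel"
    unfolding u_def using K w by (intro borel_measurable_continuous_on_indicator) auto
  have uw: "indicator S x *\<^sub>R u (h x) = indicator S x *\<^sub>R w (h x)" for x
    using K by (auto simp: u_def split: split_indicator)
  have "(LINT z:K|pushed S h. w z) = (\<integral>x. u (h x) \<partial>density lborel (indicator S))"
    unfolding pushed_def set_lebesgue_integral_def u_def[symmetric]
    by (rule integral_distr) auto
  also have "density lborel (indicator S) = density lborel (\<lambda>x. ennreal (indicator S x))"
    by (simp add: ennreal_indicator)
  also have "(\<integral>x. u (h x) \<partial>\<dots>) = (\<integral>x. indicator S x *\<^sub>R u (h x) \<partial>lborel)"
    by (rule integral_density) auto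
  finally show "(LINT z:K|pushed S h. w z) = (LINT x:S|lborel. w (h x))"
    by (simp only: set_lebesgue_integral_def uw)
  show "set_integrable lborel S (\<lambda>x. w (h x))" if cK: "compact K" and fin: "emeasure lborel S < \<infinity>"
  proof -
    obtain B where B: "\<And>x. x \<in> K \<Longrightarrow> norm (w x) \<le> B"
      using compact_imp_bounded[OF compact_continuous_image[OF w cK]] by (auto simp: bounded_iff)
    have "norm (u (h x)) \<le> B" if "x \<in> S" for x
      using B K(2)[OF that] by (simp add: u_def)
    then have "integrable lborel (\<lambda>x. indicator S x *\<^sub>R u (h x))"
      by (intro integrableI_bounded_set[of S _ _ B]) (use fin in \<open>auto split: split_indicator\<close>)
    then show ?thesis by (simp only: set_integrable_def uw)
  qed
qed

section \<open>Continuously differentiable test functions\<close>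

text \<open>
  A continuous gradient field in place of a continuous field of bounded linear forms.
\<close>
lemma C1_nbhdI:
  fixes g :: "'a::real_inner \<Rightarrow> 'a"
  assumes "open U" "K \<subseteq> U"
    and "\<And>z. z \<in> U \<Longrightarrow> (v has_derivative (\<lambda>h. h \<bullet> g z)) (at z)"
    and "continuous_on U g"
  shows "v \<in> C1_nbhd K"
proof -
  have "continuous_on U (\<lambda>z. blinfun_inner_left (g z))"
    by (intro bounded_linear.continuous_on[OF bounded_linear_blinfun_inner_left] assms)
  then show ?thesis
    unfolding C1_nbhd_def using assms
    by (intro CollectI exI[of _ U] exI[of _ "\<lambda>z. blinfun_inner_left (g z)"]) auto
qed

text \<open>
  \<^const>\<open>Lop\<close> is built from partial derivatives; where \<open>v\<close> is differentiable it is the derivative of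
  \<open>v\<close> in the direction \<open>(1, f t x)\<close>, that is, along trajectories.
\<close>
lemma Lop_eq_derivative:
  assumes v: "(v has_derivative v') (at (t, x))"
  shows "Lop f v (t, x) = v' (1, f t x)"
proof -
  have lin: "linear v'" using v by (rule has_derivative_linear)
  have sc: "v' (h, 0) = h * v' (1, 0)" "v' (0, h *\<^sub>R axis i 1) = h * v' (0, axis i 1)" for h i
    using linear_scale[OF lin, of h "(1, 0)"] linear_scale[OF lin, of h "(0, axis i 1)"] by simp_all
  have "((\<lambda>s. v (s, x)) has_derivative (\<lambda>h. v' (h, 0))) (at t)"
    by (intro has_derivative_compose[of "\<lambda>s. (s, x)" "\<lambda>h. (h, 0)" t UNIV v v'] v)
      (auto intro!: derivative_eq_intros)
  then have "((\<lambda>s. v (s, x)) has_real_derivative v' (1, 0)) (at t)"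
    unfolding has_field_derivative_def
    by (rule has_derivative_eq_rhs) (rule ext, subst sc(1), rule mult.commute)
  then have t: "deriv (\<lambda>s. v (s, x)) t = v' (1, 0)" by (rule DERIV_imp_deriv)
  have x: "space_grad v t x $ i = v' (0, axis i 1)" for i
  proof -
    have "((\<lambda>h. v (t, x + h *\<^sub>R axis i 1)) has_derivative (\<lambda>h. v' (0, h *\<^sub>R axis i 1))) (at 0)"
    proof (rule has_derivative_compose[of "\<lambda>h. (t, x + h *\<^sub>R axis i 1)" _ 0 UNIV])
      show "((\<lambda>h. (t, x + h *\<^sub>R axis i 1)) has_derivative (\<lambda>h. (0, h *\<^sub>R axis i 1))) (at 0)"
        by (auto intro!: derivative_eq_intros)
      show "(v has_derivative v') (at (t, x + 0 *\<^sub>R axis i 1))" using v by simp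
    qed
    then have "((\<lambda>h. v (t, x + h *\<^sub>R axis i 1)) has_real_derivative v' (0, axis i 1)) (at 0)"
      unfolding has_field_derivative_def
      by (rule has_derivative_eq_rhs) (rule ext, subst sc(2), rule mult.commute)
    then show ?thesis by (simp add: space_grad_def DERIV_imp_deriv)
  qed
  have "(0::real, f t x) = (\<Sum>i\<in>UNIV. (f t x $ i) *\<^sub>R (0, axis i 1))"
    by (simp add: prod_eq_iff fst_sum snd_sum vec_eq_iff sum_component axis_def if_distrib cong: if_cong)
  then have "v' (0, f t x) = (\<Sum>i\<in>UNIV. (f t x $ i) * v' (0, axis i 1))"
    by (simp only: linear_sum[OF lin] linear_scale[OF lin] real_scaleR_def)
  moreover have "v' (1, f t x) = v' (1, 0) + v' (0, f t x)"
    using linear_add[OF lin, of "(1, 0)" "(0, f t x)"] by simp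
  ultimately show ?thesis
    by (simp add: Lop_def t inner_vec_def x mult.commute)
qed

lemma C1_nbhd_continuous:
  assumes v: "v \<in> C1_nbhd K" and f: "continuous_on UNIV (\<lambda>(t, x). f t x)"
  shows "continuous_on K v" "continuous_on K (Lop f v)"
proof -
  obtain U v' where U: "open U" "K \<subseteq> U"
    "\<And>z. z \<in> U \<Longrightarrow> (v has_derivative blinfun_apply (v' z)) (at z)" "continuous_on U v'"
    using v unfolding C1_nbhd_def by blast
  show "continuous_on K v"
    by (rule has_derivative_continuous_on) (use U in \<open>blast intro: has_derivative_at_withinI\<close>)
  have "continuous_on K (\<lambda>z. blinfun_apply (v' z) (1, (\<lambda>(t, x). f t x) z))"
    using U by (intro continuous_intros continuous_on_subset[OF f]) (auto elim: continuous_on_subset)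
  moreover have "Lop f v z = blinfun_apply (v' z) (1, (\<lambda>(t, x). f t x) z)" if "z \<in> K" for z
    using that U(2) Lop_eq_derivative[OF U(3), of "fst z" "snd z" f] by (auto simp: case_prod_beta)
  ultimately show "continuous_on K (Lop f v)"
    by (simp cong: continuous_on_cong)
qed

lemma Lop_along_trajectory:
  assumes v: "v \<in> C1_nbhd K" and K: "(t, y t) \<in> K"
    and y: "(y has_vector_derivative f t (y t)) (at t within S)"
  shows "((\<lambda>s. v (s, y s)) has_vector_derivative Lop f v (t, y t)) (at t within S)"
proof -
  obtain D where D: "(v has_derivative D) (at (t, y t))"
    using v K unfolding C1_nbhd_def by blast
  have sc: "D (h, h *\<^sub>R w) = h *\<^sub>R D (1, w)" for h w
    using linear_scale[OF has_derivative_linear[OF D], of h "(1, w)"] by simp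
  have "((\<lambda>s. (s, y s)) has_derivative (\<lambda>h. (h, h *\<^sub>R f t (y t)))) (at t within S)"
    using y unfolding has_vector_derivative_def by (intro derivative_intros)
  then have "((\<lambda>s. v (s, y s)) has_derivative (\<lambda>h. D (h, h *\<^sub>R f t (y t)))) (at t within S)"
    by (rule has_derivative_compose) (rule D)
  then show ?thesis
    unfolding has_vector_derivative_def Lop_eq_derivative[OF D]
    by (rule has_derivative_eq_rhs) (rule ext, rule sc)
qed

text \<open>
  The squared positive part serves as a \<open>C\<^sup>1\<close> cut-off: it vanishes exactly on \<open>(-\<infinity>, 0]\<close>.
\<close>
lemma square_positive_part_derivative:
  "((\<lambda>s::real. (max 0 s)\<^sup>2) has_real_derivative 2 * max 0 s) (at s)"
proof -
  consider "s > 0" | "s < 0" | "s = 0" by linarith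
  then show ?thesis
  proof cases
    case 1
    have "((\<lambda>s. s\<^sup>2) has_real_derivative 2 * s) (at s)"
      by (auto intro!: derivative_eq_intros)
    then have "((\<lambda>s. (max 0 s)\<^sup>2) has_real_derivative 2 * s) (at s)"
      by (rule DERIV_cong_ev[THEN iffD1, rotated -1, OF _ refl _ refl])
        (use eventually_nhds_in_open[of "{0<..}" s] 1 in \<open>auto elim: eventually_mono\<close>)
    then show ?thesis using 1 by simp
  next
    case 2
    have "((\<lambda>s. 0) has_real_derivative 0) (at s)" by simp
    then have "((\<lambda>s. (max 0 s)\<^sup>2) has_real_derivative 0) (at s)"
      by (rule DERIV_cong_ev[THEN iffD1, rotated -1, OF _ refl _ refl])
        (use eventually_nhds_in_open[of "{..<0}" s] 2 in \<open>auto elim: eventually_mono\<close>)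
    then show ?thesis using 2 by simp
  next
    case 3
    have "((\<lambda>h::real. (max 0 h)\<^sup>2 / h) \<longlongrightarrow> 0) (at 0)"
    proof (rule Lim_null_comparison)
      show "\<forall>\<^sub>F h in at 0. norm ((max 0 h)\<^sup>2 / h) \<le> \<bar>h\<bar>"
        by (auto simp: max_def power2_eq_square)
      show "((\<lambda>h::real. \<bar>h\<bar>) \<longlongrightarrow> 0) (at 0)" by (auto intro!: tendsto_eq_intros)
    qed
    then show ?thesis using 3 by (simp add: DERIV_def)
  qed
qed

text \<open>
  Test functions must be differentiable on an open neighbourhood of \<open>[0, T] \<times> K\<close>, so a function of
  time that enters their definition has to be \<open>C\<^sup>1\<close> slightly beyond \<open>[0, T]\<close>.
\<close>
lemma C1_extension_of_solution:
  fixes p :: "real \<Rightarrow> 'a::euclidean_space"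
  assumes T: "0 \<le> T"
    and p: "\<And>t. t \<in> {0..T} \<Longrightarrow> (p has_vector_derivative d t) (at t within {0..T})"
    and d: "continuous_on {0..T} d"
  obtains P D where "\<And>t. t \<in> {0..T} \<Longrightarrow> P t = p t" "\<And>t. t \<in> {0..T} \<Longrightarrow> D t = d t"
    "continuous_on {-1<..<T+1} D" "\<And>t. t \<in> {-1<..<T+1} \<Longrightarrow> (P has_vector_derivative D t) (at t)"
proof -
  define D where "D t = d (clip T t)" for t
  define P where "P t = p 0 + (integral {-1..t} D - integral {-1..0} D)" for t
  have D: "continuous_on S D" for S
  proof -
    have "continuous_on S (d \<circ> clip T)"
      using clip_in[OF T] by (intro continuous_on_compose continuous_intros continuous_on_id
          continuous_on_subset[OF d]) auto
    then show ?thesis by (simp add: D_def[abs_def] o_def)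
  qed
  have Dd: "D t = d t" if "t \<in> {0..T}" for t using that by (simp add: D_def clip_id)
  show ?thesis
  proof
    show "D t = d t" if "t \<in> {0..T}" for t by (rule Dd[OF that])
    show "continuous_on {-1<..<T+1} D" by (rule D)
    show "(P has_vector_derivative D t) (at t)" if "t \<in> {-1<..<T+1}" for t
    proof -
      have "((\<lambda>u. integral {-1..u} D) has_vector_derivative D t) (at t within {-1..T+1})"
        by (rule integral_has_vector_derivative[OF D]) (use that in auto)
      then have "((\<lambda>u. integral {-1..u} D) has_vector_derivative D t) (at t)"
        using that by (simp add: at_within_Icc_at)
      then show ?thesis unfolding P_def by (auto intro!: derivative_eq_intros)
    qed
    show "P t = p t" if t: "t \<in> {0..T}" for t
    proof -
      have "(d has_integral p t - p 0) {0..t}"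
        by (rule fundamental_theorem_of_calculus)
          (use t in \<open>auto intro: has_vector_derivative_within_subset[OF p]\<close>)
      then have "(D has_integral p t - p 0) {0..t}"
        by (rule has_integral_eq[rotated]) (use t Dd in auto)
      then have i: "integral {0..t} D = p t - p 0" by (rule integral_unique)
      have "integral {-1..0} D + integral {0..t} D = integral {-1..t} D"
        using t by (intro Henstock_Kurzweil_Integration.integral_combine integrable_continuous_real D) auto
      then have "integral {-1..t} D - integral {-1..0} D = p t - p 0"
        unfolding i by (metis add_diff_cancel_left')
      then show ?thesis by (simp add: P_def)
    qed
  qed
qed

text \<open>
  Around the trajectory \<open>p\<close> take \<open>v (t, x) = (max 0 (r\<^sup>2 - exp (- 2 L t) |x - p t|\<^sup>2))\<^sup>2\<close>. By
  Gronwall's estimate the weighted distance \<open>exp (- 2 L t) |x - p t|\<^sup>2\<close> does not increase along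
  trajectories in \<open>K\<close>, hence \<open>v\<close> does not decrease along them, which is \<open>Lop f v \<ge> 0\<close>. The support
  of \<open>v\<close> is a tube around \<open>p\<close> of radius \<open>r exp (L t)\<close>; for small \<open>r\<close> it stays in \<open>U\<close> and ends in
  \<open>W\<close>.
\<close>
lemma tube_test_function:
  fixes f :: "real \<Rightarrow> real ^ 'n \<Rightarrow> real ^ 'n"
  assumes T: "0 \<le> T" and L: "0 \<le> L"
    and p: "\<And>t. t \<in> {0..T} \<Longrightarrow> (p has_vector_derivative f t (p t)) (at t within {0..T})"
    and f: "continuous_on UNIV (\<lambda>(t, x). f t x)"
    and lip: "\<And>t x. t \<in> {0..T} \<Longrightarrow> x \<in> K \<Longrightarrow> norm (f t x - f t (p t)) \<le> L * norm (x - p t)"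
    and U: "open U" "\<And>t. t \<in> {0..T} \<Longrightarrow> p t \<in> U" and W: "open W" "p T \<in> W"
  obtains v where "v \<in> C1_nbhd ({0..T} \<times> K)" "\<And>z. v z \<ge> 0"
    "\<And>t x. t \<in> {0..T} \<Longrightarrow> x \<in> K \<Longrightarrow> Lop f v (t, x) \<ge> 0"
    "\<And>t x. t \<in> {0..T} \<Longrightarrow> x \<notin> U \<Longrightarrow> v (t, x) = 0"
    "\<And>x. x \<notin> W \<Longrightarrow> v (T, x) = 0"
    "v (0, p 0) > 0" "continuous_on UNIV (\<lambda>x. v (0, x))"
proof -
  have pc: "continuous_on {0..T} p"
    by (rule continuous_on_vector_derivative) (rule p)
  have dc: "continuous_on {0..T} (\<lambda>t. f t (p t))"
  proof -
    have "continuous_on {0..T} ((\<lambda>(t, x). f t x) \<circ> (\<lambda>t. (t, p t)))"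
      by (intro continuous_on_compose continuous_intros pc continuous_on_subset[OF f]) auto
    then show ?thesis by (simp add: o_def)
  qed
  obtain P D where P: "\<And>t. t \<in> {0..T} \<Longrightarrow> P t = p t" "\<And>t. t \<in> {0..T} \<Longrightarrow> D t = f t (p t)"
    "continuous_on {-1<..<T+1} D" "\<And>t. t \<in> {-1<..<T+1} \<Longrightarrow> (P has_vector_derivative D t) (at t)"
    using C1_extension_of_solution[OF T p dc] by blast
  have "compact (p ` {0..T})" using pc by (rule compact_continuous_image) simp
  then obtain e where e: "e > 0" "(\<Union>x\<in>p ` {0..T}. ball x e) \<subseteq> U"
    using compact_subset_open_imp_ball_epsilon_subset[OF _ U(1), of "p ` {0..T}"] U(2) by blast
  obtain e' where e': "e' > 0" "ball (p T) e' \<subseteq> W"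
    using W by (auto simp: open_contains_ball)
  \<comment> \<open>The tube widens by the factor \<open>exp (L * t)\<close>, so it is kept below \<open>min e e'\<close> up to time \<open>T\<close>.\<close>
  define r where "r = min e e' * exp (- (L * T))"
  have r: "r > 0" using e e' by (simp add: r_def)
  have re: "r * exp (L * t) \<le> min e e'" if "t \<in> {0..T}" for t
  proof -
    have "r * exp (L * t) \<le> r * exp (L * T)"
      using that r L by (intro mult_left_mono) (auto intro: mult_left_mono)
    also have "\<dots> = min e e'" unfolding r_def mult.assoc by (simp flip: exp_add)
    finally show ?thesis .
  qed
  define E where "E t = exp (- (2 * L * t))" for t
  define y where "y z = snd z - P (fst z)" for z :: "real \<times> (real ^ 'n)"
  define q where "q z = r\<^sup>2 - E (fst z) * (y z \<bullet> y z)" for z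
  define v where "v z = (max 0 (q z))\<^sup>2" for z
  define g where "g z = (2 * max 0 (q z)) *\<^sub>R
     (2 * L * E (fst z) * (y z \<bullet> y z) + 2 * E (fst z) * (y z \<bullet> D (fst z)),
      - (2 * E (fst z)) *\<^sub>R y z)" for z
  define V where "V = {-1<..<T+1} \<times> (UNIV :: (real ^ 'n) set)"
  have V: "open V" "{0..T} \<times> K \<subseteq> V"
    unfolding V_def by (auto intro: open_Times)
  have Pc: "continuous_on {-1<..<T+1} P"
    by (rule continuous_on_vector_derivative) (blast intro: P(4) has_vector_derivative_at_within)
  have qc: "continuous_on V q" "continuous_on V y" "continuous_on V (\<lambda>z. D (fst z))"
    unfolding q_def y_def E_def
    by (auto intro!: continuous_intros continuous_on_compose2[OF Pc] continuous_on_compose2[OF P(3)] simp: V_def)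
  have dv: "(v has_derivative (\<lambda>h. h \<bullet> g z)) (at z)" if z: "z \<in> V" for z
  proof -
    have t: "fst z \<in> {-1<..<T+1}" using z by (auto simp: V_def)
    have "((\<lambda>z. P (fst z)) has_derivative (\<lambda>h. fst h *\<^sub>R D (fst z))) (at z)"
      by (rule has_derivative_compose[of fst fst z UNIV, OF _ P(4)[OF t, unfolded has_vector_derivative_def]])
        (auto intro!: derivative_eq_intros)
    then have yd: "(y has_derivative (\<lambda>h. snd h - fst h *\<^sub>R D (fst z))) (at z)"
      unfolding y_def by (auto intro!: derivative_eq_intros)
    have Ed: "((\<lambda>z. E (fst z)) has_derivative (\<lambda>h. - (2 * L * E (fst z)) * fst h)) (at z)"
      unfolding E_def by (auto intro!: derivative_eq_intros simp: algebra_simps)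
    have qd: "(q has_derivative (\<lambda>h. - (E (fst z) * (y z \<bullet> (snd h - fst h *\<^sub>R D (fst z)) + (snd h - fst h *\<^sub>R D (fst z)) \<bullet> y z)
        + (- (2 * L * E (fst z)) * fst h) * (y z \<bullet> y z)))) (at z)"
      unfolding q_def
      by (rule has_derivative_eq_rhs, (rule derivative_intros Ed yd)+) auto
    have "(v has_derivative (\<lambda>h. 2 * max 0 (q z) * (- (E (fst z) * (y z \<bullet> (snd h - fst h *\<^sub>R D (fst z)) + (snd h - fst h *\<^sub>R D (fst z)) \<bullet> y z)
        + (- (2 * L * E (fst z)) * fst h) * (y z \<bullet> y z))))) (at z)"
      unfolding v_def
      by (rule has_derivative_compose[OF qd, of "\<lambda>s. (max 0 s)\<^sup>2" "(*) (2 * max 0 (q z))"])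
        (use square_positive_part_derivative[of "q z"] in \<open>simp add: has_field_derivative_def\<close>)
    then show ?thesis
      by (rule has_derivative_eq_rhs)
        (auto simp: g_def fun_eq_iff inner_Pair inner_diff_left inner_diff_right inner_commute
          algebra_simps inner_prod_def)
  qed
  have gc: "continuous_on V g"
    unfolding g_def E_def by (intro continuous_intros qc)
  have q_pos: "norm (x - p t) < min e e'" if "q (t, x) > 0" "t \<in> {0..T}" for t x
  proof -
    have "(norm (x - p t))\<^sup>2 * exp (- (2 * L * t)) < r\<^sup>2"
      using that P(1) by (simp add: q_def y_def E_def dot_square_norm mult.commute)
    then have "(norm (x - p t))\<^sup>2 < r\<^sup>2 * exp (2 * L * t)"
      by (simp add: exp_minus inverse_eq_divide pos_divide_less_eq)
    also have "\<dots> = (r * exp (L * t))\<^sup>2"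
      by (simp add: power_mult_distrib exp_double mult.assoc)
    finally have "(norm (x - p t))\<^sup>2 < (r * exp (L * t))\<^sup>2" .
    then have "norm (x - p t) < r * exp (L * t)"
      by (rule power2_less_imp_less) (use r in simp)
    then show ?thesis using re[OF that(2)] by linarith
  qed
  show ?thesis
  proof
    show "v \<in> C1_nbhd ({0..T} \<times> K)" using V dv gc by (rule C1_nbhdI)
    show "v z \<ge> 0" for z by (simp add: v_def)
    show "v (t, x) = 0" if "t \<in> {0..T}" "x \<notin> U" for t x
    proof -
      have "ball (p t) e \<subseteq> U" using e(2) that(1) by blast
      then have "\<not> norm (x - p t) < min e e'" using that by (auto simp: dist_norm norm_minus_commute)
      then show ?thesis using q_pos[of t x] that by (force simp: v_def max_def)
    qed
    show "v (T, x) = 0" if "x \<notin> W" for x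
    proof -
      have "\<not> norm (x - p T) < min e e'" using e' that by (auto simp: dist_norm norm_minus_commute)
      then show ?thesis using q_pos[of T x] T by (force simp: v_def max_def)
    qed
    show "v (0, p 0) > 0" using r P(1)[of 0] T by (simp add: v_def q_def y_def)
    show "continuous_on UNIV (\<lambda>x. v (0, x))"
      unfolding v_def q_def y_def by (simp, intro continuous_intros)
    show "Lop f v (t, x) \<ge> 0" if t: "t \<in> {0..T}" and x: "x \<in> K" for t x
    proof -
      define w where "w = x - p t"
      have "(t, x) \<in> V" using V t x by auto
      then have "Lop f v (t, x) = (1, f t x) \<bullet> g (t, x)"
        by (rule Lop_eq_derivative[OF dv])
      also have "\<dots> = 4 * max 0 (q (t, x)) * E t * (L * (w \<bullet> w) - w \<bullet> (f t x - f t (p t)))"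
        using t by (simp add: g_def y_def P inner_Pair w_def inner_diff_right inner_commute algebra_simps)
      also have "\<dots> \<ge> 0"
      proof -
        have "w \<bullet> (f t x - f t (p t)) \<le> norm w * norm (f t x - f t (p t))"
          by (rule norm_cauchy_schwarz)
        also have "\<dots> \<le> norm w * (L * norm w)"
          using lip[OF t x] by (intro mult_left_mono) (auto simp: w_def)
        also have "\<dots> = L * (w \<bullet> w)" by (simp add: dot_square_norm power2_eq_square)
        finally show ?thesis by (simp add: E_def)
      qed
      finally show ?thesis .
    qed
  qed
qed

section \<open>The region of attraction in terms of the flow\<close>

text \<open>
  The flow \<open>\<phi>\<close> of a globally Lipschitz field \<open>F\<close> that agrees with \<open>f\<close> over the constraint set
  \<open>{gX \<ge> 0}\<close>. As long as a trajectory of \<open>F\<close> remains in that set it is a trajectory of \<open>f\<close>.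
\<close>
locale roa_flow =
  fixes T L :: real
    and f F :: "real \<Rightarrow> real ^ 'n \<Rightarrow> real ^ 'n"
    and gX gT :: "real ^ 'n \<Rightarrow> real"
    and \<phi> :: "real ^ 'n \<Rightarrow> real \<Rightarrow> real ^ 'n"
  assumes T: "0 < T" and L: "0 < L"
    and f_cont: "continuous_on UNIV (\<lambda>(t, x). f t x)"
    and gX_cont: "continuous_on UNIV gX" and gT_cont: "continuous_on UNIV gT"
    and boundary_null: "boundary_set gX \<in> null_sets lborel"
    and compact_outer: "compact (outer_set gX)"
    and F_lip: "\<And>t x y. norm (F t x - F t y) \<le> L * norm (x - y)"
    and F_eq: "\<And>t x. t \<in> {0..T} \<Longrightarrow> x \<in> outer_set gX \<Longrightarrow> F t x = f t x"
    and flow_0: "\<And>x. \<phi> x 0 = x"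
    and flow: "\<And>x t. t \<in> {0..T} \<Longrightarrow> (\<phi> x has_vector_derivative F t (\<phi> x t)) (at t within {0..T})"
    and flow_cont: "continuous_on UNIV (\<lambda>(t, x). \<phi> x t)"
begin

lemma flow_cont_compose [continuous_intros]:
  "continuous_on S a \<Longrightarrow> continuous_on S b \<Longrightarrow> continuous_on S (\<lambda>z. \<phi> (a z) (b z))"
  using continuous_on_compose2[OF flow_cont, of S "\<lambda>z. (b z, a z)"] by (auto intro: continuous_intros)

lemma gX_cont_compose [continuous_intros]: "continuous_on S a \<Longrightarrow> continuous_on S (\<lambda>z. gX (a z))"
  by (rule continuous_on_compose2[OF gX_cont]) auto

lemma gT_cont_compose [continuous_intros]: "continuous_on S a \<Longrightarrow> continuous_on S (\<lambda>z. gT (a z))"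
  by (rule continuous_on_compose2[OF gT_cont]) auto

lemma inner_subset_outer: "inner_set gX \<subseteq> outer_set gX"
  by (auto simp: inner_set_def outer_set_def)

lemma open_inner: "open (inner_set gX)"
  unfolding inner_set_def by (intro open_Collect_less continuous_intros)

lemma closed_boundary: "closed (boundary_set gX)"
  unfolding boundary_set_def by (intro closed_Collect_eq continuous_intros)

lemma closed_target_compl: "closed (target_compl gX gT)"
proof -
  have "target_compl gX gT = {x. 0 \<le> gX x} \<inter> {x. gT x \<le> 0}" by (auto simp: target_compl_def)
  then show ?thesis by (simp only:) (intro closed_Int closed_Collect_le continuous_intros)
qed

text \<open>
  Membership asks for some solution of the original equation; such a solution stays where \<open>F = f\<close>
  and therefore is the trajectory of \<open>\<phi>\<close>, by uniqueness.
\<close>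
lemma attraction_region_iff:
  "x \<in> attraction_region T f gX gT \<longleftrightarrow> (\<forall>s\<in>{0..T}. gX (\<phi> x s) > 0) \<and> gT (\<phi> x T) > 0"
proof
  assume "x \<in> attraction_region T f gX gT"
  then obtain y where y: "solution_on T f y" "y 0 = x" "\<And>t. t \<in> {0..T} \<Longrightarrow> y t \<in> inner_set gX"
    "y T \<in> target_set gT"
    by (auto simp: attraction_region_def)
  have yF: "(y has_vector_derivative F t (y t)) (at t within {0..T})" if "t \<in> {0..T}" for t
    using y(1,3) that inner_subset_outer F_eq by (metis solution_on_def subsetD)
  have "y t = \<phi> x t" if "t \<in> {0..T}" for t
    using ode_dependence_on_initial_value[OF F_lip yF flow[of _ x] that] y(2) by (simp add: flow_0)
  then show "(\<forall>s\<in>{0..T}. gX (\<phi> x s) > 0) \<and> gT (\<phi> x T) > 0"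
    using y(3,4) T by (auto simp: inner_set_def target_set_def)
next
  assume *: "(\<forall>s\<in>{0..T}. gX (\<phi> x s) > 0) \<and> gT (\<phi> x T) > 0"
  then have X: "\<phi> x t \<in> inner_set gX" if "t \<in> {0..T}" for t
    using that by (simp add: inner_set_def)
  have "solution_on T f (\<phi> x)"
    unfolding solution_on_def using flow[of _ x] X inner_subset_outer F_eq by (metis subsetD)
  then show "x \<in> attraction_region T f gX gT"
    unfolding attraction_region_def using X X[of 0] * T flow_0
    by (auto simp: target_set_def)
qed

lemma stays_inner_iff:
  "(\<forall>s\<in>{0..t}. gX (\<phi> x s) > 0) \<longleftrightarrow> \<not> (\<exists>s. s \<in> {0..t} \<and> gX (\<phi> x s) \<le> 0)"
  by (meson not_le)

lemma closed_leaving: "closed {x. \<exists>s. s \<in> {0..T} \<and> gX (\<phi> x s) \<le> 0}"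
proof -
  have "closed {z :: real \<times> (real ^ 'n). gX (\<phi> (snd z) (fst z)) \<le> 0}"
    by (intro closed_Collect_le continuous_intros)
  then have "closed {x. \<exists>s. s \<in> {0..T} \<and> (s, x) \<in> {z :: real \<times> (real ^ 'n). gX (\<phi> (snd z) (fst z)) \<le> 0}}"
    by (intro closed_compact_projection) auto
  then show ?thesis by simp
qed

lemma open_attraction_region: "open (attraction_region T f gX gT)"
proof -
  have "attraction_region T f gX gT =
      - {x. \<exists>s. s \<in> {0..T} \<and> gX (\<phi> x s) \<le> 0} \<inter> {x. 0 < gT (\<phi> x T)}"
    by (simp add: set_eq_iff attraction_region_iff stays_inner_iff del: atLeastAtMost_iff)
  moreover have "open {x. 0 < gT (\<phi> x T)}"
    by (intro open_Collect_less continuous_intros)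
  ultimately show ?thesis using closed_leaving by (simp add: open_Int open_Compl)
qed

abbreviation C where "C \<equiv> attraction_compl T f gX gT"

lemma C_borel: "C \<in> sets borel"
  unfolding attraction_compl_def using open_inner open_attraction_region by auto

lemma C_subset: "C \<subseteq> inner_set gX" "C \<subseteq> outer_set gX"
  using inner_subset_outer by (auto simp: attraction_compl_def)

lemma emeasure_C_finite: "emeasure lborel C < \<infinity>"
  using emeasure_mono[OF C_subset(2), of lborel] emeasure_compact_finite[OF compact_outer] compact_outer
  by (auto simp: borel_compact intro: le_less_trans)

section \<open>No feasible initial measure charges the region of attraction\<close>

text \<open>
  Insert the tube function around the trajectory of \<open>x\<close> into the transport equation. It vanishes
  on \<open>[0, T] \<times> {gX = 0}\<close>, where \<open>\<mu>T1\<close> lives, and at time \<open>T\<close> on the complement of the target,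
  where \<open>\<mu>T2\<close> lives, so the integral of \<open>v (0, _)\<close> over \<open>\<mu>0\<close> equals minus that of \<open>Lop f v \<ge> 0\<close>
  over \<open>\<mu>\<close>. Since \<open>v \<ge> 0\<close>, both integrals are zero, and \<open>v (0, _)\<close> is positive near \<open>x\<close>.
\<close>
lemma attraction_region_avoids_spt:
  assumes feas: "feasible T f gX gT \<mu>0 \<mu> \<mu>T1 \<mu>T2 \<mu>h0" and x: "x \<in> attraction_region T f gX gT"
  shows "x \<notin> spt \<mu>0"
proof -
  let ?K = "outer_set gX"
  have m0: "sets \<mu>0 = sets borel" "finite_measure \<mu>0" "spt \<mu>0 \<subseteq> ?K"
    using feas by (auto simp: feasible_def nonneg_measures_def)
  interpret finite_measure \<mu>0 by fact
  have X: "\<phi> x t \<in> inner_set gX" if "t \<in> {0..T}" for t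
    using x that by (auto simp: attraction_region_iff inner_set_def)
  have deriv: "(\<phi> x has_vector_derivative f t (\<phi> x t)) (at t within {0..T})" if "t \<in> {0..T}" for t
    using flow[OF that, of x] F_eq[OF that] X[OF that] inner_subset_outer by auto
  have lip: "norm (f t y - f t (\<phi> x t)) \<le> L * norm (y - \<phi> x t)" if "t \<in> {0..T}" "y \<in> ?K" for t y
    using F_lip[of t y "\<phi> x t"] F_eq[OF that(1)] X[OF that(1)] that(2) inner_subset_outer by auto
  have W: "open {y. 0 < gT y}" by (intro open_Collect_less continuous_intros)
  obtain v where v: "v \<in> C1_nbhd ({0..T} \<times> ?K)" "\<And>z. v z \<ge> 0"
    "\<And>t y. t \<in> {0..T} \<Longrightarrow> y \<in> ?K \<Longrightarrow> Lop f v (t, y) \<ge> 0"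
    "\<And>t y. t \<in> {0..T} \<Longrightarrow> y \<notin> inner_set gX \<Longrightarrow> v (t, y) = 0"
    "\<And>y. y \<notin> {y. 0 < gT y} \<Longrightarrow> v (T, y) = 0"
    "v (0, \<phi> x 0) > 0" "continuous_on UNIV (\<lambda>y. v (0, y))"
    by (rule tube_test_function[of T L "\<phi> x" f ?K "inner_set gX" "{y. 0 < gT y}"])
      (use T L deriv f_cont lip open_inner X W x in \<open>auto simp: attraction_region_iff\<close>)
  have "(LINT z:{0..T} \<times> boundary_set gX|\<mu>T1. v z) = (LINT z:{0..T} \<times> boundary_set gX|\<mu>T1. 0)"
    unfolding set_lebesgue_integral_def
    by (intro Bochner_Integration.integral_cong) (auto simp: boundary_set_def inner_set_def v(4) split: split_indicator)
  moreover have "(LINT y:target_compl gX gT|\<mu>T2. v (T, y)) = (LINT y:target_compl gX gT|\<mu>T2. 0)"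
    unfolding set_lebesgue_integral_def
    by (intro Bochner_Integration.integral_cong) (auto simp: target_compl_def v(5) split: split_indicator)
  moreover have "(LINT z:{0..T} \<times> ?K|\<mu>. Lop f v z) \<ge> 0"
    unfolding set_lebesgue_integral_def
    by (intro Bochner_Integration.integral_nonneg) (auto simp: v(3) split: split_indicator)
  moreover have "(LINT z:{0..T} \<times> boundary_set gX|\<mu>T1. v z) + (LINT y:target_compl gX gT|\<mu>T2. v (T, y))
      - (LINT y:?K|\<mu>0. v (0, y)) = (LINT z:{0..T} \<times> ?K|\<mu>. Lop f v z)"
    using feas v(1) unfolding feasible_def by blast
  ultimately have "(LINT y:?K|\<mu>0. v (0, y)) \<le> 0"
    by simp
  moreover have "(LINT y:?K|\<mu>0. v (0, y)) \<ge> 0"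
    unfolding set_lebesgue_integral_def using v(2)
    by (intro Bochner_Integration.integral_nonneg) (auto split: split_indicator)
  ultimately have "(\<integral>y. indicator ?K y *\<^sub>R v (0, y) \<partial>\<mu>0) = 0"
    by (simp add: set_lebesgue_integral_def)
  moreover have "set_integrable \<mu>0 ?K (\<lambda>y. v (0, y))"
    using m0 compact_outer by (intro set_integrable_continuous_compact continuous_on_subset[OF v(7)])
      (auto simp: less_top[symmetric])
  ultimately have "AE y in \<mu>0. indicator ?K y *\<^sub>R v (0, y) = 0"
    using v(2) by (subst (asm) integral_nonneg_eq_0_iff_AE) (auto simp: set_integrable_def)
  moreover have "AE y in \<mu>0. y \<in> ?K"
    using m0 by (intro spt_subset_imp_AE)
  ultimately have "AE y in \<mu>0. \<not> 0 < v (0, y)"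
    by eventually_elim auto
  moreover have op: "open {y. 0 < v (0, y)}"
    by (intro open_Collect_less continuous_on_const v(7))
  ultimately have "emeasure \<mu>0 {y. 0 < v (0, y)} = 0"
    using AE_iff_measurable[of "{y. 0 < v (0, y)}" \<mu>0 "\<lambda>y. \<not> 0 < v (0, y)"] m0(1)
      sets_eq_imp_space_eq[OF m0(1)] by auto
  then show ?thesis
    using op v(6) unfolding spt_def flow_0 by (auto simp: less_le)
qed

text \<open>
  The initial measure sits on the compact set \<open>{gX \<ge> 0}\<close> minus the region of attraction and is
  dominated by Lebesgue measure there. This set exceeds the complement region only by a part of
  the null set \<open>{gX = 0}\<close>.
\<close>
lemma feasible_mass_le:
  assumes feas: "feasible T f gX gT \<mu>0 \<mu> \<mu>T1 \<mu>T2 \<mu>h0"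
  shows "measure \<mu>0 UNIV \<le> measure lborel C"
proof -
  let ?K = "outer_set gX" and ?R = "attraction_region T f gX gT"
  have m0: "sets \<mu>0 = sets borel" "finite_measure \<mu>0" "spt \<mu>0 \<subseteq> ?K"
    and mh: "\<And>w :: real ^ 'n \<Rightarrow> real. continuous_on ?K w \<Longrightarrow>
      (LINT x:?K|\<mu>0. w x) + (LINT x:?K|\<mu>h0. w x) = (LINT x:?K|lborel. w x)"
    using feas by (auto simp: feasible_def nonneg_measures_def)
  interpret finite_measure \<mu>0 by fact
  have S: "compact (?K - ?R)" using compact_outer open_attraction_region by (rule compact_diff)
  have "AE x in \<mu>0. x \<in> ?K - ?R"
    using m0 attraction_region_avoids_spt[OF feas] by (intro spt_subset_imp_AE) auto
  then have "measure \<mu>0 UNIV = measure \<mu>0 (?K - ?R)"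
    using m0(1) S by (intro measure_eq_AE) (auto simp: borel_compact)
  also have "\<dots> \<le> measure lborel (?K - ?R)"
  proof (rule measure_compact_le_lborel[OF m0(1,2) compact_outer S])
    fix w :: "real ^ 'n \<Rightarrow> real"
    assume w: "continuous_on UNIV w" "\<And>x. 0 \<le> w x"
    have "0 \<le> (LINT x:?K|\<mu>h0. w x)"
      unfolding set_lebesgue_integral_def using w(2)
      by (intro Bochner_Integration.integral_nonneg) (auto split: split_indicator)
    then show "(LINT x:?K|\<mu>0. w x) \<le> (LINT x:?K|lborel. w x)"
      using mh[OF continuous_on_subset[OF w(1)]] by simp
  qed auto
  also have "\<dots> = measure lborel C"
  proof (rule measure_eq_AE)
    have "AE x in lborel. x \<notin> boundary_set gX" using boundary_null by (rule AE_not_in)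
    then show "AE x in lborel. x \<in> ?K - ?R \<longleftrightarrow> x \<in> C"
      by eventually_elim
        (auto simp: boundary_set_def outer_set_def inner_set_def attraction_compl_def)
  qed (use S C_borel in \<open>auto simp: borel_compact\<close>)
  finally show ?thesis .
qed

section \<open>The occupation measure of the stopped flow\<close>

definition alive where "alive = {(x, t). t \<in> {0..T} \<and> (\<forall>s\<in>{0..t}. gX (\<phi> x s) > 0)}"

text \<open>
  The first time at which the trajectory from \<open>x\<close> meets \<open>{gX \<le> 0}\<close>, or \<open>T\<close> if there is none. As
  the length of a section of a Borel set it is measurable by Fubini's theorem.
\<close>
definition exit_time where "exit_time x = measure lborel {t. (x, t) \<in> alive}"

definition staying where "staying = {x \<in> C. \<forall>s\<in>{0..T}. gX (\<phi> x s) > 0}"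

lemma staying_borel: "staying \<in> sets borel"
proof -
  have "staying = C - {x. \<exists>s. s \<in> {0..T} \<and> gX (\<phi> x s) \<le> 0}"
    by (simp add: set_eq_iff staying_def stays_inner_iff del: atLeastAtMost_iff)
  then show ?thesis using C_borel closed_leaving by auto
qed

text \<open>
  The complement is, within times in \<open>[0, T]\<close>, the projection of a closed set along the compact
  interval of possible exit times.
\<close>
lemma alive_borel: "alive \<in> sets borel"
proof -
  define Z where "Z = {z :: real \<times> ((real ^ 'n) \<times> real). fst z \<le> snd (snd z)}
    \<inter> {z. gX (\<phi> (fst (snd z)) (fst z)) \<le> 0}"
  have "closed Z"
    unfolding Z_def by (intro closed_Int closed_Collect_le continuous_intros)
  then have "closed {y. \<exists>s. s \<in> {0..T} \<and> (s, y) \<in> Z}"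
    by (intro closed_compact_projection) auto
  moreover have "alive = (UNIV \<times> {0..T}) - {y. \<exists>s. s \<in> {0..T} \<and> (s, y) \<in> Z}"
  proof -
    have "(x, t) \<in> alive \<longleftrightarrow> t \<in> {0..T} \<and> \<not> (\<exists>s. s \<in> {0..T} \<and> (s, x, t) \<in> Z)" for x t
    proof (cases "t \<in> {0..T}")
      case True
      then have "s \<in> {0..T} \<and> s \<le> t \<longleftrightarrow> s \<in> {0..t}" for s by auto
      then show ?thesis
        using True by (simp add: alive_def Z_def stays_inner_iff flip: conj_assoc del: atLeastAtMost_iff)
    qed (simp add: alive_def del: atLeastAtMost_iff)
    then show ?thesis by (auto simp del: atLeastAtMost_iff)
  qed
  moreover have "closed ((UNIV :: (real ^ 'n) set) \<times> {0..T})"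
    by (intro closed_Times) auto
  ultimately show ?thesis by (simp only:) (intro sets.Diff borel_closed)
qed

lemma exit_time_measurable [measurable]: "exit_time \<in> borel_measurable borel"
proof -
  have "alive \<in> sets (lborel \<Otimes>\<^sub>M lborel)"
    using alive_borel by (subst lborel_prod) simp
  then have "(\<lambda>x. emeasure lborel (Pair x -` alive)) \<in> borel_measurable lborel"
    by (rule lborel.measurable_emeasure_Pair)
  then have "(\<lambda>x. enn2real (emeasure lborel (Pair x -` alive))) \<in> borel_measurable borel"
    by simp
  then show ?thesis
    by (simp add: exit_time_def[abs_def] measure_def vimage_def)
qed

lemma aliveD:
  assumes "(x, t) \<in> alive"
  shows "t \<in> {0..T}" "gX (\<phi> x t) > 0"
proof -
  from assms show t: "t \<in> {0..T}" by (simp add: alive_def)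
  then have "t \<in> {0..t}" by simp
  with assms show "gX (\<phi> x t) > 0" unfolding alive_def by blast
qed

lemma staying_exit_time:
  assumes "x \<in> staying"
  shows "(x, t) \<in> alive \<longleftrightarrow> t \<in> {0..T}" "exit_time x = T"
proof -
  show iff: "(x, t) \<in> alive \<longleftrightarrow> t \<in> {0..T}" for t
    using assms by (auto simp: alive_def staying_def)
  show "exit_time x = T"
    unfolding exit_time_def iff Collect_mem_eq using T by simp
qed

text \<open>
  The set \<open>Z\<close> of times with \<open>gX \<le> 0\<close> is compact and has a least element \<open>\<sigma>\<close>. The trajectory starts
  in \<open>{gX > 0}\<close>, so by the intermediate value theorem \<open>gX\<close> vanishes somewhere on \<open>[0, \<sigma>]\<close>, and by
  minimality at \<open>\<sigma>\<close>.
\<close>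
lemma leaving_exit_time:
  assumes "x \<in> C - staying"
  shows "(x, t) \<in> alive \<longleftrightarrow> t \<in> {0..<exit_time x}" "exit_time x \<in> {0..T}"
    "gX (\<phi> x (exit_time x)) = 0"
proof -
  define Z where "Z = {0..T} \<inter> {t. gX (\<phi> x t) \<le> 0}"
  have "closed {t. gX (\<phi> x t) \<le> 0}"
    by (intro closed_Collect_le continuous_intros)
  then have Z: "compact Z" unfolding Z_def by (intro compact_Int_closed) auto
  have "\<exists>s. s \<in> {0..T} \<and> gX (\<phi> x s) \<le> 0"
    using assms unfolding staying_def stays_inner_iff by blast
  then have "Z \<noteq> {}" unfolding Z_def by blast
  then obtain \<sigma> where s: "\<sigma> \<in> Z" "\<And>t. t \<in> Z \<Longrightarrow> \<sigma> \<le> t"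
    using compact_attains_inf[OF Z] by blast
  have sT: "\<sigma> \<in> {0..T}" and s0: "gX (\<phi> x \<sigma>) \<le> 0" using s(1) by (auto simp: Z_def)
  have alive: "(x, t) \<in> alive \<longleftrightarrow> t \<in> {0..<\<sigma>}" for t
  proof
    assume a: "(x, t) \<in> alive"
    have "\<not> \<sigma> \<le> t"
    proof
      assume "\<sigma> \<le> t"
      then have "\<sigma> \<in> {0..t}" using sT by simp
      then have "gX (\<phi> x \<sigma>) > 0" using a unfolding alive_def by blast
      then show False using s0 by simp
    qed
    then show "t \<in> {0..<\<sigma>}" using aliveD(1)[OF a] by simp
  next
    assume t: "t \<in> {0..<\<sigma>}"
    have "gX (\<phi> x u) > 0" if "u \<in> {0..t}" for u
    proof -
      have "u \<notin> Z" using s(2)[of u] that t by auto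
      then show ?thesis using that t sT by (simp add: Z_def)
    qed
    then show "(x, t) \<in> alive" using t sT by (simp add: alive_def)
  qed
  have e: "exit_time x = \<sigma>"
    unfolding exit_time_def alive Collect_mem_eq using sT by simp
  show "(x, t) \<in> alive \<longleftrightarrow> t \<in> {0..<exit_time x}" unfolding e by (rule alive)
  show "exit_time x \<in> {0..T}" unfolding e by (rule sT)
  have "gX (\<phi> x 0) > 0" using assms C_subset(1) by (auto simp: flow_0 inner_set_def)
  then have "\<exists>t\<ge>0. t \<le> \<sigma> \<and> gX (\<phi> x t) = 0"
    using s0 sT by (intro IVT2'[of "\<lambda>t. gX (\<phi> x t)" \<sigma> 0 0])
      (auto intro!: gX_cont_compose flow_cont_compose continuous_on_const continuous_on_id)
  then obtain t where t: "0 \<le> t" "t \<le> \<sigma>" "gX (\<phi> x t) = 0" by blast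
  then have "\<sigma> \<le> t" using sT by (intro s(2)) (simp add: Z_def)
  then show "gX (\<phi> x (exit_time x)) = 0" unfolding e using t by simp
qed

lemma exit_time_in:
  assumes "x \<in> C"
  shows "exit_time x \<in> {0..T}"
proof (cases "x \<in> staying")
  case True
  from staying_exit_time(2)[OF this] show ?thesis using T by simp
next
  case False
  with assms have "x \<in> C - staying" by simp
  then show ?thesis by (rule leaving_exit_time(2))
qed

lemma alive_imp_before_exit:
  assumes x: "x \<in> C" and a: "(x, t) \<in> alive"
  shows "t \<in> {0..exit_time x}"
proof (cases "x \<in> staying")
  case True
  then show ?thesis using a staying_exit_time[OF True] by (simp only:)
next
  case False
  then have "x \<in> C - staying" using x by simp
  from leaving_exit_time(1)[OF this] a show ?thesis by simp
qed

lemma before_exit_imp_alive: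
  assumes x: "x \<in> C" and t: "t \<in> {0..<exit_time x}"
  shows "(x, t) \<in> alive"
proof (cases "x \<in> staying")
  case True
  then show ?thesis using t staying_exit_time[OF True] by simp
next
  case False
  then have "x \<in> C - staying" using x by simp
  from leaving_exit_time(1)[OF this] t show ?thesis by simp
qed

lemma flow_in_outer:
  assumes x: "x \<in> C" and t: "t \<in> {0..exit_time x}"
  shows "\<phi> x t \<in> outer_set gX"
proof -
  have "gX (\<phi> x t) \<ge> 0"
  proof (cases "(x, t) \<in> alive")
    case True
    from aliveD(2)[OF this] show ?thesis by simp
  next
    case False
    then have te: "t = exit_time x" using before_exit_imp_alive[OF x, of t] t
      by (cases "t = exit_time x") auto
    have "x \<notin> staying"
    proof
      assume "x \<in> staying"
      from staying_exit_time(1)[OF this, of t] False exit_time_in[OF x] show False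
        unfolding te by blast
    qed
    then show ?thesis using leaving_exit_time(3)[of x] x te by simp
  qed
  then show ?thesis by (simp add: outer_set_def)
qed

text \<open>
  The fundamental theorem of calculus on \<open>[0, exit_time x]\<close>. The section of the set \<open>alive\<close> over
  \<open>x\<close> may lack the right endpoint of this interval, which is a null set.
\<close>
lemma test_function_along_flow:
  assumes v: "v \<in> C1_nbhd ({0..T} \<times> outer_set gX)" and x: "x \<in> C"
  shows "(\<integral>t. indicator alive (x, t) * Lop f v (t, \<phi> x t) \<partial>lborel)
    = v (exit_time x, \<phi> x (exit_time x)) - v (0, x)"
proof -
  let ?\<tau> = "exit_time x"
  have \<tau>: "?\<tau> \<in> {0..T}" by (rule exit_time_in[OF x])
  have LK: "continuous_on ({0..T} \<times> outer_set gX) (Lop f v)" by (rule C1_nbhd_continuous(2)[OF v f_cont])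
  have c: "continuous_on {0..?\<tau>} (\<lambda>t. Lop f v (t, \<phi> x t))"
    by (rule continuous_on_compose2[OF LK]) (use \<tau> flow_in_outer[OF x] in \<open>auto intro!: continuous_intros\<close>)
  have "(\<integral>t. indicator alive (x, t) * Lop f v (t, \<phi> x t) \<partial>lborel)
      = (\<integral>t. indicator {0..?\<tau>} t *\<^sub>R Lop f v (t, \<phi> x t) \<partial>lborel)"
  proof (rule integral_cong_AE)
    have m: "(\<lambda>t. indicator {0..?\<tau>} t *\<^sub>R Lop f v (t, \<phi> x t)) \<in> borel_measurable lborel"
      using borel_measurable_continuous_on_indicator[OF _ c] by simp
    then show "(\<lambda>t. indicator {0..?\<tau>} t *\<^sub>R Lop f v (t, \<phi> x t)) \<in> borel_measurable lborel" .
    have "{t. (x, t) \<in> alive} = Pair x -` alive" by auto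
    moreover have "Pair x -` alive \<in> sets lborel"
      using alive_borel by (intro sets_Pair1[of _ lborel]) (subst lborel_prod, simp)
    ultimately have "{t. (x, t) \<in> alive} \<in> sets borel" by simp
    then have "(\<lambda>t. indicator {t. (x, t) \<in> alive} t * (indicator {0..?\<tau>} t *\<^sub>R Lop f v (t, \<phi> x t)))
        \<in> borel_measurable lborel"
      using m by (intro borel_measurable_times borel_measurable_indicator) auto
    moreover have "(\<lambda>t. indicator {t. (x, t) \<in> alive} t * (indicator {0..?\<tau>} t *\<^sub>R Lop f v (t, \<phi> x t)))
      = (\<lambda>t. indicator alive (x, t) * Lop f v (t, \<phi> x t))"
      using alive_imp_before_exit[OF x] by (auto simp: fun_eq_iff split: split_indicator)
    ultimately show "(\<lambda>t. indicator alive (x, t) * Lop f v (t, \<phi> x t)) \<in> borel_measurable lborel"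
      by simp
    show "AE t in lborel. indicator alive (x, t) * Lop f v (t, \<phi> x t) =
        indicator {0..?\<tau>} t *\<^sub>R Lop f v (t, \<phi> x t)"
    proof -
      have "AE t in lborel. t \<noteq> ?\<tau>" by (rule AE_lborel_singleton)
      then show ?thesis
      proof eventually_elim
        case (elim t)
        then have "(x, t) \<in> alive \<longleftrightarrow> t \<in> {0..?\<tau>}"
          using alive_imp_before_exit[OF x, of t] before_exit_imp_alive[OF x, of t] by auto
        then show ?case by (simp add: indicator_def)
      qed
    qed
  qed
  also have "\<dots> = v (?\<tau>, \<phi> x ?\<tau>) - v (0, \<phi> x 0)"
  proof (rule integral_FTC_atLeastAtMost[OF _ _ c])
    show "0 \<le> ?\<tau>" using \<tau> by simp
    fix t assume t: "0 \<le> t" "t \<le> ?\<tau>"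
    then have tT: "t \<in> {0..T}" and K: "\<phi> x t \<in> outer_set gX" using \<tau> flow_in_outer[OF x] by auto
    have "(\<phi> x has_vector_derivative f t (\<phi> x t)) (at t within {0..?\<tau>})"
      using flow[OF tT, of x] F_eq[OF tT K] \<tau> by (auto intro: has_vector_derivative_within_subset)
    then show "((\<lambda>t. v (t, \<phi> x t)) has_vector_derivative Lop f v (t, \<phi> x t)) (at t within {0..?\<tau>})"
      by (intro Lop_along_trajectory[OF v]) (use tT K in auto)
  qed
  finally show ?thesis by (simp add: flow_0)
qed

text \<open>
  Start with Lebesgue measure on the complement region and stop each trajectory at its exit time:
  the following are its occupation measure, the distribution of the exit point in time-space for
  trajectories that reach \<open>{gX = 0}\<close>, and the distribution at time \<open>T\<close> of the others.
\<close>
definition occupation where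
  "occupation = pushed (alive \<inter> C \<times> UNIV) (\<lambda>z. (snd z, \<phi> (fst z) (snd z)))"

definition exit_boundary where
  "exit_boundary = pushed (C - staying) (\<lambda>x. (exit_time x, \<phi> x (exit_time x)))"

definition final_compl where "final_compl = pushed staying (\<lambda>x. \<phi> x T)"

text \<open>
  The transport equation is the identity of the fundamental theorem along each stopped trajectory,
  integrated over initial points in the complement region with Fubini's theorem. Points that never
  leave have exit time \<open>T\<close>, and the end of their trajectory misses the target because they lie
  outside the region of attraction.
\<close>
lemma feasible_flow:
  "feasible T f gX gT (density lborel (indicator C)) occupation exit_boundary final_compl
     (density lborel (indicator (outer_set gX - C)))"
proof -
  let ?K = "outer_set gX"
  have Kc: "closed ?K" and Kb: "?K \<in> sets borel" using compact_outer
    by (auto intro: compact_imp_closed borel_compact)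
  have sub_fin: "emeasure lborel S < \<infinity>" if "S \<subseteq> ?K" for S
    using emeasure_mono[OF that, of lborel] emeasure_compact_finite[OF compact_outer] Kb
    by (auto intro: le_less_trans)
  have stC: "staying \<subseteq> C" by (auto simp: staying_def)
  let ?A = "alive \<inter> C \<times> UNIV" and ?h = "\<lambda>z. (snd z, \<phi> (fst z) (snd z))"
  let ?e = "\<lambda>x. (exit_time x, \<phi> x (exit_time x))"
  have Ab: "?A \<in> sets borel"
  proof -
    have "C \<times> UNIV \<in> sets ((lborel :: (real ^ 'n) measure) \<Otimes>\<^sub>M (lborel :: real measure))"
      using C_borel by auto
    then have "C \<times> UNIV \<in> sets (borel :: ((real ^ 'n) \<times> real) measure)"
      by (subst (asm) lborel_prod) simp
    then show ?thesis using alive_borel by auto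
  qed
  have Afin: "emeasure lborel ?A < \<infinity>"
  proof -
    have "?A \<subseteq> ?K \<times> {0..T}" using C_subset by (auto simp: alive_def)
    then have "emeasure lborel ?A \<le> emeasure lborel (?K \<times> {0..T})"
      using Kb by (intro emeasure_mono) (auto simp: borel_Times)
    also have "\<dots> < \<infinity>" by (intro emeasure_compact_finite compact_Times compact_outer) simp
    finally show ?thesis .
  qed
  have Ah: "?h z \<in> {0..T} \<times> ?K" if "z \<in> ?A" for z
    using aliveD[of "fst z" "snd z"] that by (auto simp: outer_set_def)
  have hm: "?h \<in> borel_measurable borel"
    by (intro borel_measurable_continuous_onI continuous_intros)
  have em: "?e \<in> borel_measurable borel"
  proof -
    have "(\<lambda>x. \<phi> x (exit_time x)) \<in> borel_measurable borel"
      by (rule borel_measurable_continuous_Pair[of "\<lambda>x. x" _ exit_time "\<phi>"])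
        (auto intro!: flow_cont_compose continuous_on_fst continuous_on_snd continuous_on_id)
    then show ?thesis by (intro borel_measurable_Pair exit_time_measurable)
  qed
  have eD: "?e x \<in> {0..T} \<times> boundary_set gX" if "x \<in> C - staying" for x
    using leaving_exit_time[OF that] by (auto simp: boundary_set_def)
  have fE: "\<phi> x T \<in> target_compl gX gT" if "x \<in> staying" for x
  proof -
    have s: "\<forall>s\<in>{0..T}. gX (\<phi> x s) > 0" and "x \<notin> attraction_region T f gX gT"
      using that by (auto simp: staying_def attraction_compl_def)
    then have "\<not> gT (\<phi> x T) > 0" by (simp add: attraction_region_iff del: atLeastAtMost_iff)
    moreover have "gX (\<phi> x T) > 0" using s T by simp
    ultimately show ?thesis by (simp add: target_compl_def)
  qed
  have fm: "(\<lambda>x. \<phi> x T) \<in> borel_measurable borel"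
    by (intro borel_measurable_continuous_onI continuous_intros)
  have KT: "compact ({0..T} \<times> ?K)" by (intro compact_Times compact_outer) simp
  have bT: "closed ({0..T} \<times> boundary_set gX)" by (intro closed_Times closed_boundary) simp
  have DE: "C - staying \<in> sets borel" "staying \<in> sets borel" "?K - C \<in> sets borel"
    using C_borel staying_borel Kb by auto
  have fin: "emeasure lborel (C - staying) < \<infinity>" "emeasure lborel staying < \<infinity>" "emeasure lborel (?K - C) < \<infinity>"
    by (rule sub_fin, use C_subset stC in blast)+
  have nn: "density lborel (indicator C) \<in> nonneg_measures ?K"
    "occupation \<in> nonneg_measures ({0..T} \<times> ?K)"
    "exit_boundary \<in> nonneg_measures ({0..T} \<times> boundary_set gX)"
    "final_compl \<in> nonneg_measures (target_compl gX gT)"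
    "density lborel (indicator (?K - C)) \<in> nonneg_measures ?K"
  proof -
    show "density lborel (indicator C) \<in> nonneg_measures ?K"
      unfolding density_indicator_eq_pushed
      by (rule pushed_in_nonneg_measures[OF C_borel emeasure_C_finite _ Kc]) (use C_subset in auto)
    show "occupation \<in> nonneg_measures ({0..T} \<times> ?K)"
      unfolding occupation_def
      by (rule pushed_in_nonneg_measures[OF Ab Afin hm compact_imp_closed[OF KT] Ah])
    show "exit_boundary \<in> nonneg_measures ({0..T} \<times> boundary_set gX)"
      unfolding exit_boundary_def
      by (rule pushed_in_nonneg_measures[OF DE(1) fin(1) em bT eD])
    show "final_compl \<in> nonneg_measures (target_compl gX gT)"
      unfolding final_compl_def
      by (rule pushed_in_nonneg_measures[OF DE(2) fin(2) fm closed_target_compl fE])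
    show "density lborel (indicator (?K - C)) \<in> nonneg_measures ?K"
      unfolding density_indicator_eq_pushed
      by (rule pushed_in_nonneg_measures[OF DE(3) fin(3) _ Kc]) auto
  qed
  have w: "(LINT x:?K|density lborel (indicator C). w x) + (LINT x:?K|density lborel (indicator (?K - C)). w x)
      = (LINT x:?K|lborel. w x)" if w: "continuous_on ?K w" for w :: "real ^ 'n \<Rightarrow> real"
  proof -
    have int: "set_integrable lborel ?K w"
      using compact_outer w by (intro set_integrable_continuous_compact emeasure_compact_finite) auto
    have "(LINT x:?K|density lborel (indicator C). w x) + (LINT x:?K|density lborel (indicator (?K - C)). w x)
        = (LINT x:C|lborel. w x) + (LINT x:?K - C|lborel. w x)"
      unfolding density_indicator_eq_pushed
      using C_borel DE Kc C_subset w by (subst (1 2) integral_pushed) auto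
    also have "\<dots> = (LINT x:C \<union> (?K - C)|lborel. w x)"
      using C_borel DE C_subset by (subst set_integral_Un) (auto intro!: set_integrable_subset[OF int])
    also have "C \<union> (?K - C) = ?K" using C_subset by auto
    finally show ?thesis .
  qed
  have v: "(LINT z:{0..T} \<times> boundary_set gX|exit_boundary. v z) + (LINT x:target_compl gX gT|final_compl. v (T, x))
      - (LINT x:?K|density lborel (indicator C). v (0, x)) = (LINT z:{0..T} \<times> ?K|occupation. Lop f v z)"
    if v: "v \<in> C1_nbhd ({0..T} \<times> ?K)" for v
  proof -
    have vc: "continuous_on ({0..T} \<times> ?K) v" and Lc: "continuous_on ({0..T} \<times> ?K) (Lop f v)"
      using C1_nbhd_continuous[OF v f_cont] by auto
    have bK: "boundary_set gX \<subseteq> ?K" "target_compl gX gT \<subseteq> ?K"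
      by (auto simp: boundary_set_def outer_set_def target_compl_def)
    have vT: "continuous_on S (\<lambda>x. v (T, x))" "continuous_on S (\<lambda>x. v (0, x))" if "S \<subseteq> ?K" for S
      using T that by (auto intro!: continuous_on_compose2[OF vc] continuous_intros)
    have eK: "?e x \<in> {0..T} \<times> ?K" if "x \<in> C" for x
      using flow_in_outer[OF that, of "exit_time x"] exit_time_in[OF that] by auto
    have q: "set_integrable lborel C (\<lambda>x. v (?e x))"
      by (rule set_integrable_pushed[OF C_borel em compact_imp_closed[OF KT] eK vc KT emeasure_C_finite])
    have q0: "set_integrable lborel C (\<lambda>x. v (0, x))"
      by (rule set_integrable_pushed[OF C_borel _ Kc _ vT(2) compact_outer emeasure_C_finite])
        (use C_subset in auto)
    have "(LINT z:{0..T} \<times> boundary_set gX|exit_boundary. v z) = (LINT x:C - staying|lborel. v (?e x))"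
      unfolding exit_boundary_def
      by (rule integral_pushed[OF DE(1) em bT eD]) (use bK in \<open>auto intro: continuous_on_subset[OF vc]\<close>)
    moreover have "(LINT x:target_compl gX gT|final_compl. v (T, x)) = (LINT x:staying|lborel. v (T, \<phi> x T))"
      unfolding final_compl_def
      by (rule integral_pushed[OF DE(2) fm closed_target_compl fE vT(1)[OF bK(2)]])
    moreover have "\<dots> = (LINT x:staying|lborel. v (?e x))"
      by (rule set_lebesgue_integral_cong) (use DE staying_exit_time(2) in auto)
    moreover have "(LINT x:C - staying|lborel. v (?e x)) + (LINT x:staying|lborel. v (?e x))
        = (LINT x:C|lborel. v (?e x))"
      using DE stC by (subst set_integral_Un[symmetric]) (auto intro!: set_integrable_subset[OF q] simp: Un_absorb2)
    moreover have "(LINT x:?K|density lborel (indicator C). v (0, x)) = (LINT x:C|lborel. v (0, x))"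
      unfolding density_indicator_eq_pushed
      using C_borel Kc C_subset vT(2)[of ?K] by (subst integral_pushed) auto
    moreover have "(LINT x:C|lborel. v (?e x)) - (LINT x:C|lborel. v (0, x))
        = (LINT x:C|lborel. v (?e x) - v (0, x))"
      using q q0 by (rule set_integral_diff(2)[symmetric])
    moreover have "(LINT z:{0..T} \<times> ?K|occupation. Lop f v z) = (LINT x:C|lborel. v (?e x) - v (0, x))"
    proof -
      have int: "integrable (lborel \<Otimes>\<^sub>M lborel) (\<lambda>z. indicator ?A z *\<^sub>R Lop f v (?h z))"
        using set_integrable_pushed[OF Ab hm compact_imp_closed[OF KT] Ah Lc KT Afin]
        by (simp add: set_integrable_def lborel_prod)
      have "(LINT z:{0..T} \<times> ?K|occupation. Lop f v z) = (LINT z:?A|lborel. Lop f v (?h z))"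
        unfolding occupation_def
        by (rule integral_pushed[OF Ab hm compact_imp_closed[OF KT] Ah Lc])
      also have "\<dots> = (\<integral>z. indicator ?A z *\<^sub>R Lop f v (?h z) \<partial>(lborel \<Otimes>\<^sub>M lborel))"
        by (simp add: set_lebesgue_integral_def lborel_prod)
      also have "\<dots> = (\<integral>x. \<integral>t. indicator ?A (x, t) *\<^sub>R Lop f v (?h (x, t)) \<partial>lborel \<partial>lborel)"
        using lborel_pair.integral_fst'[OF int] by simp
      also have "\<dots> = (\<integral>x. indicator C x * (\<integral>t. indicator alive (x, t) * Lop f v (t, \<phi> x t) \<partial>lborel) \<partial>lborel)"
      proof (rule Bochner_Integration.integral_cong[OF refl])
        fix x :: "real ^ 'n"
        have "indicator ?A (x, t) *\<^sub>R Lop f v (?h (x, t))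
            = indicator C x * (indicator alive (x, t) * Lop f v (t, \<phi> x t))" for t
          by (simp split: split_indicator)
        then show "(\<integral>t. indicator ?A (x, t) *\<^sub>R Lop f v (?h (x, t)) \<partial>lborel)
            = indicator C x * (\<integral>t. indicator alive (x, t) * Lop f v (t, \<phi> x t) \<partial>lborel)"
          by (simp only: integral_mult_right_zero)
      qed
      also have "\<dots> = (LINT x:C|lborel. v (?e x) - v (0, x))"
        unfolding set_lebesgue_integral_def using test_function_along_flow[OF v]
        by (intro Bochner_Integration.integral_cong refl) (auto split: split_indicator)
      finally show ?thesis .
    qed
    ultimately show ?thesis by simp
  qed
  show ?thesis unfolding feasible_def by (intro conjI ballI allI impI nn w v)
qed

end

theorem theorem1:
  fixes T :: real
    and f :: "real \<Rightarrow> real ^ 'n \<Rightarrow> real ^ 'n"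
    and gX gT :: "real ^ 'n \<Rightarrow> real"
  assumes "T > 0"
    and "\<And>i. real_polynomial_function (\<lambda>(t, x). f t x $ i)"
    and "real_polynomial_function gX"
    and "real_polynomial_function gT"
    and "inner_set gX \<noteq> {}"
    and "compact (outer_set gX)"
    and "bounded (target_set gT)"
    and "target_set gT \<subseteq> inner_set gX"
  shows "attraction_compl T f gX gT \<in> sets borel
    \<and> p_star T f gX gT = enn2ereal (emeasure lborel (attraction_compl T f gX gT))
    \<and> (\<exists>\<mu> \<mu>T1 \<mu>T2 \<mu>h0.
         feasible T f gX gT (density lborel (indicator (attraction_compl T f gX gT))) \<mu> \<mu>T1 \<mu>T2 \<mu>h0
         \<and> ereal (LINT x|density lborel (indicator (attraction_compl T f gX gT)). 1)
           = p_star T f gX gT)"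
proof -
  have T: "0 \<le> T" using assms(1) by simp
  obtain F L where F: "0 < L" "continuous_on UNIV (\<lambda>(t, x). F t x)"
    "\<And>t x y. norm (F t x - F t y) \<le> L * norm (x - y)"
    "\<And>t x. t \<in> {0..T} \<Longrightarrow> x \<in> outer_set gX \<Longrightarrow> F t x = f t x"
    by (rule real_polynomial_field_extension[OF T assms(2) compact_imp_bounded[OF assms(6)]],
        rule that, assumption+)
  obtain \<phi> where \<phi>: "\<And>x. \<phi> x 0 = x"
    "\<And>x t. t \<in> {0..T} \<Longrightarrow> (\<phi> x has_vector_derivative F t (\<phi> x t)) (at t within {0..T})"
    "continuous_on UNIV (\<lambda>(t, x). \<phi> x t)"
    by (rule ode_flow_exists[OF T F(1) continuous_on_subset[OF F(2) subset_UNIV] F(3)],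
        rule that, assumption+)
  have f_cont: "continuous_on UNIV (\<lambda>(t, x). f t x)"
    using assms(2) by (rule continuous_on_real_polynomial_field)
  obtain a where "gX a > 0" using assms(5) by (auto simp: inner_set_def)
  then have null: "boundary_set gX \<in> null_sets lborel"
    unfolding boundary_set_def by (intro real_polynomial_function_zeros_null[OF assms(3), of a]) simp
  interpret roa_flow T L f F gX gT \<phi>
    by (rule roa_flow.intro[OF assms(1) F(1) f_cont
          continuous_on_real_polynomial_function[OF assms(3)]
          continuous_on_real_polynomial_function[OF assms(4)] null assms(6) F(3,4) \<phi>])
  let ?m0 = "density lborel (indicator C)"
  have val: "(LINT x|?m0. 1) = measure lborel C"
    using C_borel by (simp add: measure_def emeasure_density)
  have enn: "enn2ereal (emeasure lborel C) = ereal (measure lborel C)"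
    using emeasure_C_finite by (simp add: emeasure_eq_ennreal_measure less_top[symmetric])
  have p: "p_star T f gX gT = ereal (measure lborel C)"
    unfolding p_star_def
  proof (rule antisym)
    show "Sup {ereal (LINT x|\<mu>0. 1) |\<mu>0 \<mu> \<mu>T1 \<mu>T2 \<mu>h0. feasible T f gX gT \<mu>0 \<mu> \<mu>T1 \<mu>T2 \<mu>h0}
        \<le> ereal (measure lborel C)"
    proof (rule Sup_least, clarify)
      fix \<mu>0 \<mu> \<mu>T1 \<mu>T2 \<mu>h0
      assume feas: "feasible T f gX gT \<mu>0 \<mu> \<mu>T1 \<mu>T2 \<mu>h0"
      then have "space \<mu>0 = UNIV"
        by (auto simp: feasible_def nonneg_measures_def dest: sets_eq_imp_space_eq)
      then show "ereal (LINT x|\<mu>0. 1) \<le> ereal (measure lborel C)"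
        using feasible_mass_le[OF feas] by simp
    qed
    show "ereal (measure lborel C)
        \<le> Sup {ereal (LINT x|\<mu>0. 1) |\<mu>0 \<mu> \<mu>T1 \<mu>T2 \<mu>h0. feasible T f gX gT \<mu>0 \<mu> \<mu>T1 \<mu>T2 \<mu>h0}"
    proof (rule Sup_upper)
      show "ereal (measure lborel C)
          \<in> {ereal (LINT x|\<mu>0. 1) |\<mu>0 \<mu> \<mu>T1 \<mu>T2 \<mu>h0. feasible T f gX gT \<mu>0 \<mu> \<mu>T1 \<mu>T2 \<mu>h0}"
        unfolding val[symmetric] using feasible_flow by blast
    qed
  qed
  show ?thesis
    unfolding p enn val using C_borel feasible_flow by blast
qed

end
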